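(* Let $d\in\mathbb{N}$, let $\Omega \subset \mathbb{R}^{d}$ be open, let $p\in\mathbb{N}\cup\{\infty\}$, and let $\psi \in C^{p} (\Omega, \Omega)$ and $\omega \in C^{p} (\Omega, \mathbb{K})$. Let $C_{\omega,\psi}:C^p(\Omega,\mathbb{K})\to C^p(\Omega,\mathbb{K})$, $f\mapsto \omega\cdot(f\circ\psi)$. If $C_{\omega, \psi }$ is mixing on $C^p(\Omega, \mathbb{K})$, then it is chaotic.
   Context: $\mathbb{K}$ is $\mathbb{R}$ or $\mathbb{C}$; $\mathbb{N}$ is the set of positive integers and $\mathbb{N}_0=\mathbb{N}\cup\{0\}$. For $p\in\mathbb{N}\cup\{\infty\}$, $C^p(\Omega,\mathbb{K})$ is the separable Fréchet space of functions $f:\Omega\to\mathbb{K}$ all of whose partial derivatives of order at most $p$ (of every order, if $p=\infty$) exist and are continuous, with the seminorms $\|f\|_{K,n}=\max_{|\alpha|\le n}\max_{x\in K}\left|\frac{\partial^{|\alpha|}f}{\partial x^\alpha}(x)\right|$, $K\subset\Omega$ compact, $n\in\mathbb{N}_0$, $n\le p$. $C^p(\Omega,\Omega)$ is the set of maps $F=(f_1,\dots,f_d):\Omega\to\Omega$ with every $f_j\in C^p(\Omega,\mathbb{R})$. Let $T$ be an operator (continuous linear self-map) on a topological vector space $X$. $T$ is transitive (respectively, mixing) if for all non-empty open $U,V\subset X$, $T^n(U)\cap V\neq\emptyset$ for some $n$ (respectively, for all large $n$). $T$ is chaotic if it is transitive and its set of periodic points $\bigcup_{n\in\mathbb{N}}\ker(T^n-I)$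 is dense in $X$. *)

theory Defs
  imports "HOL-Analysis.Analysis" "HOL-Library.Extended_Nat"
begin

section \<open>Functions of class $C^p$\<close>

text \<open>
  The scalar field is a type \<open>'k\<close>, to be instantiated to \<^typ>\<open>real\<close> or \<^typ>\<open>complex\<close>.
  Partial derivatives are indexed by words of coordinates: the word \<open>[i\<^sub>1, \<dots>, i\<^sub>m]\<close> stands for
  differentiating in the coordinate \<open>i\<^sub>m\<close> first and \<open>i\<^sub>1\<close> last, a derivative of order \<open>m\<close>.
  For functions of class $C^p$ and \<open>m \<le> p\<close> the result depends only on the multi-index \<open>\<alpha>\<close>
  counting the occurrences of each coordinate, and then \<open>m = |\<alpha>|\<close>.
\<close>

definition partial :: "'d \<Rightarrow> (real^'d \<Rightarrow> 'k::real_normed_field) \<Rightarrow> real^'d \<Rightarrow> 'k" where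
  "partial i f x = vector_derivative (\<lambda>t. f (x + t *\<^sub>R axis i 1)) (at 0)"

primrec partials :: "'d list \<Rightarrow> (real^'d \<Rightarrow> 'k::real_normed_field) \<Rightarrow> real^'d \<Rightarrow> 'k" where
  "partials [] f = f"
| "partials (i # w) f = partial i (partials w f)"

definition Cp_on :: "enat \<Rightarrow> (real^'d) set \<Rightarrow> (real^'d \<Rightarrow> 'k::real_normed_field) \<Rightarrow> bool" where
  "Cp_on p \<Omega> f \<longleftrightarrow>
     (\<forall>w. enat (length w) \<le> p \<longrightarrow> continuous_on \<Omega> (partials w f)) \<and>
     (\<forall>w. enat (length w) < p \<longrightarrow>
        (\<forall>i. \<forall>x\<in>\<Omega>. (\<lambda>t. partials w f (x + t *\<^sub>R axis i 1)) differentiable (at 0)))"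

text \<open>
  A function on \<open>\<Omega>\<close> is encoded as a total function vanishing outside \<open>\<Omega>\<close>, so that equality
  means equality on \<open>\<Omega>\<close> and the functions form a linear space under pointwise operations.
  Since \<open>\<Omega>\<close> is open, the values outside it do not affect derivatives at points of \<open>\<Omega>\<close>;
  \<open>f\<close> is not required to be regular, or even continuous, at the boundary.
\<close>

definition Cp_space :: "enat \<Rightarrow> (real^'d) set \<Rightarrow> (real^'d \<Rightarrow> 'k::real_normed_field) set" where
  "Cp_space p \<Omega> = {f. Cp_on p \<Omega> f \<and> (\<forall>x. x \<notin> \<Omega> \<longrightarrow> f x = 0)}"

definition Cp_self_map :: "enat \<Rightarrow> (real^'d) set \<Rightarrow> (real^'d \<Rightarrow> real^'d) \<Rightarrow> bool" where
  "Cp_self_map p \<Omega> \<psi> \<longleftrightarrow> \<psi> ` \<Omega> \<subseteq> \<Omega> \<and> (\<forall>j. Cp_on p \<Omega> (\<lambda>x. \<psi> x $ j))"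

text \<open>
  Inserting \<open>0\<close> only matters for \<open>K = {}\<close>. For compact \<open>K \<noteq> {}\<close> and \<open>f\<close> of class $C^p$, \<open>n \<le> p\<close>,
  the supremum is attained and is the maximum.
\<close>

definition Cp_seminorm ::
    "(real^'d) set \<Rightarrow> nat \<Rightarrow> (real^'d \<Rightarrow> 'k::real_normed_field) \<Rightarrow> real" where
  "Cp_seminorm K n f =
     (MAX w \<in> {w. length w \<le> n}. Sup (insert 0 ((\<lambda>x. norm (partials w f x)) ` K)))"

definition Cp_topology ::
    "enat \<Rightarrow> (real^'d) set \<Rightarrow> (real^'d \<Rightarrow> 'k::real_normed_field) topology" where
  "Cp_topology p \<Omega> = topology_generated_by
     {{g \<in> Cp_space p \<Omega>. Cp_seminorm K n (\<lambda>x. g x - f x) < \<epsilon>} | f K n \<epsilon>.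
        f \<in> Cp_space p \<Omega> \<and> compact K \<and> K \<subseteq> \<Omega> \<and> enat n \<le> p \<and> \<epsilon> > 0}"


section \<open>Dynamics of a self-map of a topological space\<close>

definition transitive_map :: "'a topology \<Rightarrow> ('a \<Rightarrow> 'a) \<Rightarrow> bool" where
  "transitive_map X T \<longleftrightarrow>
     (\<forall>U V. openin X U \<and> U \<noteq> {} \<and> openin X V \<and> V \<noteq> {} \<longrightarrow>
        (\<exists>n\<ge>1. (T ^^ n) ` U \<inter> V \<noteq> {}))"

definition mixing_map :: "'a topology \<Rightarrow> ('a \<Rightarrow> 'a) \<Rightarrow> bool" where
  "mixing_map X T \<longleftrightarrow>
     (\<forall>U V. openin X U \<and> U \<noteq> {} \<and> openin X V \<and> V \<noteq> {} \<longrightarrow>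
        (\<forall>\<^sub>F n in sequentially. (T ^^ n) ` U \<inter> V \<noteq> {}))"

definition periodic_points :: "'a topology \<Rightarrow> ('a \<Rightarrow> 'a) \<Rightarrow> 'a set" where
  "periodic_points X T = {x \<in> topspace X. \<exists>n\<ge>1. (T ^^ n) x = x}"

definition chaotic_map :: "'a topology \<Rightarrow> ('a \<Rightarrow> 'a) \<Rightarrow> bool" where
  "chaotic_map X T \<longleftrightarrow>
     transitive_map X T \<and> X closure_of (periodic_points X T) = topspace X"


section \<open>Weighted composition operators\<close>

definition weighted_comp ::
    "(real^'d) set \<Rightarrow> (real^'d \<Rightarrow> 'k::real_normed_field) \<Rightarrow> (real^'d \<Rightarrow> real^'d)
       \<Rightarrow> (real^'d \<Rightarrow> 'k) \<Rightarrow> real^'d \<Rightarrow> 'k" where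
  "weighted_comp \<Omega> \<omega> \<psi> f = (\<lambda>x. if x \<in> \<Omega> then \<omega> x * f (\<psi> x) else 0)"

end

theory Submission
  imports Defs
begin

text \<open>
  If \<open>T = C\<^bsub>\<omega>,\<psi>\<^esub>\<close> is mixing, then \<open>\<omega>\<close> has no zeros, \<open>\<psi>\<close> is injective with invertible derivatives,
  and for every compact \<open>K\<close> the sets \<open>\<psi>\<^sup>n K\<close> and \<open>K\<close> are disjoint for all large \<open>n\<close>. So for a
  function \<open>f\<close> with compact support \<open>L\<close> and all large \<open>m\<close>, the series \<open>\<Sum>k\<in>\<int>. T\<^sup>k\<^sup>m f\<close> is locally finite, where
  the negative powers are defined by transporting compactly supported functions along the
  diffeomorphism \<open>\<psi>\<^sup>m : \<Omega> \<rightarrow> \<psi>\<^sup>m \<Omega>\<close> and extending them by \<open>0\<close>. The sum is fixed by \<open>T\<^sup>m\<close> and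
  equals \<open>f\<close> on \<open>L\<close>. Multiplying an arbitrary function by a cutoff that is \<open>1\<close> near a given compact
  set, one obtains periodic points in each of its neighbourhoods.
\<close>

section \<open>Differentiability classes via the derivative\<close>

text \<open>The conditions on \<open>\<omega>\<close>, on injectivity and on the derivatives all
  come from the density of the range of \<open>T\<close>: if one failed, a nonzero continuous
  functional built from values or first derivatives at one or two points would vanish on every
  \<open>T h\<close>. Running away needs more, namely passages in both directions between two open
  sets at the same exponent, and mixing supplies them. The power \<open>T ^^ m\<close> is again a
  mixing weighted composition operator, with symbol \<open>\<psi> ^^ m\<close>, so it suffices to
  construct fixed points. The obstacle is the regularity of the negative powers. The inverse of an
  injective C^p map is C^p only where the derivative is invertible, and dividing by the transported
  weight may blow up at boundary points of the image that lie inside \<open>\<Omega>\<close>; a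
  compact support stays away from them. Chain rule and inverse function are awkward for iterated
  partial derivatives, so the definitions are first translated into total derivatives.\<close>

text \<open>Recording the derivative through its values at basis vectors keeps the codomain fixed,
  so that induction on the order needs no spaces of linear maps. The derivative is taken
  \<open>at x\<close>, which makes the notion the usual one for open \<open>S\<close>.\<close>

primrec Ck_on :: "nat \<Rightarrow> 'a::euclidean_space set \<Rightarrow> ('a \<Rightarrow> 'b::real_normed_vector) \<Rightarrow> bool" where
  "Ck_on 0 S f \<longleftrightarrow> continuous_on S f"
| "Ck_on (Suc n) S f \<longleftrightarrow> f differentiable_on S \<and>
     (\<forall>b\<in>Basis. Ck_on n S (\<lambda>x. frechet_derivative f (at x) b))"

lemma Ck_on_cong_imp:
  assumes "open S" "Ck_on n S f" "\<And>x. x \<in> S \<Longrightarrow> f x = g x"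
  shows "Ck_on n S g"
  using assms(2,3)
proof (induction n arbitrary: f g)
  case 0
  then show ?case by (auto cong: continuous_on_cong)
next
  case (Suc n)
  have der: "(g has_derivative frechet_derivative f (at x)) (at x)" if "x \<in> S" for x
  proof (rule has_derivative_transform_within_open[OF _ \<open>open S\<close> that])
    show "(f has_derivative frechet_derivative f (at x)) (at x)"
      using Suc.prems(1) that \<open>open S\<close>
      by (simp add: differentiable_on_eq_differentiable_at flip: frechet_derivative_works)
  qed (use Suc.prems(2) in auto)
  have eq: "frechet_derivative g (at x) = frechet_derivative f (at x)" if "x \<in> S" for x
    using frechet_derivative_at[OF der[OF that]] by simp
  have "g differentiable_on S"
    using der \<open>open S\<close> by (auto simp: differentiable_on_eq_differentiable_at differentiable_def)
  moreover have "Ck_on n S (\<lambda>x. frechet_derivative g (at x) b)" if "b \<in> Basis" for b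
    by (rule Suc.IH[of "\<lambda>x. frechet_derivative f (at x) b"]) (use Suc.prems that eq in auto)
  ultimately show ?case by simp
qed

lemma Ck_on_SucI:
  assumes "open S" "\<And>x. x \<in> S \<Longrightarrow> (f has_derivative F x) (at x)"
    and "\<And>b. b \<in> Basis \<Longrightarrow> Ck_on n S (\<lambda>x. F x b)"
  shows "Ck_on (Suc n) S f"
proof -
  have "f differentiable_on S"
    using assms(1,2) by (auto simp: differentiable_on_eq_differentiable_at differentiable_def)
  moreover have "Ck_on n S (\<lambda>x. frechet_derivative f (at x) b)" if "b \<in> Basis" for b
    by (rule Ck_on_cong_imp[OF assms(1) assms(3)[OF that]])
       (simp add: frechet_derivative_at[OF assms(2)])
  ultimately show ?thesis by simp
qed

lemma Ck_on_SucD: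
  assumes "open S" "Ck_on (Suc n) S f" "x \<in> S"
  shows "(f has_derivative frechet_derivative f (at x)) (at x)"
  using assms by (simp add: differentiable_on_eq_differentiable_at flip: frechet_derivative_works)

lemma Ck_on_Suc_imp: "open S \<Longrightarrow> Ck_on (Suc n) S f \<Longrightarrow> Ck_on n S f"
proof (induction n arbitrary: f)
  case 0
  then show ?case by (simp add: differentiable_imp_continuous_on)
next
  case (Suc n)
  from Suc.prems have "f differentiable_on S" by simp
  moreover have "Ck_on n S (\<lambda>x. frechet_derivative f (at x) b)" if "b \<in> Basis" for b
    by (rule Suc.IH[OF Suc.prems(1)]) (use Suc.prems that in simp)
  ultimately show ?case by simp
qed

lemma Ck_on_le: "open S \<Longrightarrow> Ck_on n S f \<Longrightarrow> m \<le> n \<Longrightarrow> Ck_on m S f"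
  by (induction n) (auto simp: le_Suc_eq simp del: Ck_on.simps dest: Ck_on_Suc_imp)

lemma Ck_on_imp_continuous_on: "open S \<Longrightarrow> Ck_on n S f \<Longrightarrow> continuous_on S f"
  using Ck_on_le[of S n f 0] by simp

lemma Ck_on_subset: "Ck_on n S f \<Longrightarrow> T \<subseteq> S \<Longrightarrow> Ck_on n T f"
  by (induction n arbitrary: f) (auto intro: continuous_on_subset differentiable_on_subset)

text \<open>Meant for functions with different formulas near different points: an extension by zero
  and a locally finite sum.\<close>

lemma Ck_on_local:
  assumes "\<And>x. x \<in> S \<Longrightarrow> \<exists>U. open U \<and> x \<in> U \<and> Ck_on n U f"
  shows "Ck_on n S f"
  using assms
proof (induction n arbitrary: f)
  case 0
  show ?case
    unfolding Ck_on.simps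
  proof (intro continuous_at_imp_continuous_on ballI)
    fix x assume "x \<in> S"
    with 0 show "isCont f x"
      by (metis Ck_on.simps(1) at_within_open continuous_on_eq_continuous_within)
  qed
next
  case (Suc n)
  have "f differentiable_on S"
    unfolding differentiable_on_def
  proof
    fix x assume "x \<in> S"
    with Suc.prems obtain U where "open U" "x \<in> U" "f differentiable_on U" by force
    then show "f differentiable (at x within S)"
      by (metis differentiable_at_withinI differentiable_on_eq_differentiable_at)
  qed
  moreover have "Ck_on n S (\<lambda>x. frechet_derivative f (at x) b)" if "b \<in> Basis" for b
    by (rule Suc.IH) (use Suc.prems that in fastforce)
  ultimately show ?case by simp
qed

lemma Ck_on_const [simp]: "Ck_on n S (\<lambda>x. c)"
  by (induction n arbitrary: c) auto

lemma Ck_on_bounded_linear_compose: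
  assumes "bounded_linear h" "open S" "Ck_on n S f"
  shows "Ck_on n S (\<lambda>x. h (f x))"
  using assms(3)
proof (induction n arbitrary: f)
  case 0
  then show ?case by (simp add: assms(1) bounded_linear.continuous_on)
next
  case (Suc n)
  show ?case
  proof (rule Ck_on_SucI[OF \<open>open S\<close>])
    fix x assume "x \<in> S"
    show "((\<lambda>x. h (f x)) has_derivative (\<lambda>y. h (frechet_derivative f (at x) y))) (at x)"
      by (rule bounded_linear.has_derivative[OF assms(1) Ck_on_SucD[OF \<open>open S\<close> Suc.prems \<open>x \<in> S\<close>]])
  qed (use Suc in auto)
qed

lemma Ck_on_id [simp]: "open S \<Longrightarrow> Ck_on n S (\<lambda>x. x)"
  by (cases n) (auto intro!: Ck_on_SucI derivative_eq_intros simp del: Ck_on.simps(2))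

lemma Ck_on_add:
  assumes "open S" "Ck_on n S f" "Ck_on n S g"
  shows "Ck_on n S (\<lambda>x. f x + g x)"
  using assms(2,3)
proof (induction n arbitrary: f g)
  case 0
  then show ?case by (simp add: continuous_on_add)
next
  case (Suc n)
  show ?case
  proof (rule Ck_on_SucI[OF \<open>open S\<close>])
    fix x assume "x \<in> S"
    show "((\<lambda>x. f x + g x) has_derivative
      (\<lambda>y. frechet_derivative f (at x) y + frechet_derivative g (at x) y)) (at x)"
      by (intro has_derivative_add Ck_on_SucD[OF \<open>open S\<close> Suc.prems(1) \<open>x \<in> S\<close>]
          Ck_on_SucD[OF \<open>open S\<close> Suc.prems(2) \<open>x \<in> S\<close>])
  qed (use Suc in auto)
qed

lemma Ck_on_minus: "open S \<Longrightarrow> Ck_on n S f \<Longrightarrow> Ck_on n S (\<lambda>x. - f x)"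
  by (rule Ck_on_bounded_linear_compose[OF bounded_linear_minus[OF bounded_linear_ident]])

lemma Ck_on_diff:
  "open S \<Longrightarrow> Ck_on n S f \<Longrightarrow> Ck_on n S g \<Longrightarrow> Ck_on n S (\<lambda>x. f x - g x)"
  using Ck_on_add[OF _ _ Ck_on_minus, of S n f g] by simp

lemma Ck_on_sum:
  "open S \<Longrightarrow> (\<And>i. i \<in> I \<Longrightarrow> Ck_on n S (f i)) \<Longrightarrow> Ck_on n S (\<lambda>x. \<Sum>i\<in>I. f i x)"
  by (induction I rule: infinite_finite_induct) (auto intro: Ck_on_add)

text \<open>The Leibniz rule in a form that serves the field product, the scalar multiple and the
  inner product at once.\<close>

lemma (in bounded_bilinear) Ck_on:
  fixes S :: "'d::euclidean_space set"
  assumes "open S" "Ck_on n S f" "Ck_on n S g"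
  shows "Ck_on n S (\<lambda>x. prod (f x) (g x))"
  using assms(2,3)
proof (induction n arbitrary: f g)
  case 0
  then show ?case by (simp add: continuous_on)
next
  case (Suc n)
  show ?case
  proof (rule Ck_on_SucI[OF \<open>open S\<close>])
    fix x assume "x \<in> S"
    show "((\<lambda>x. prod (f x) (g x)) has_derivative
      (\<lambda>y. prod (f x) (frechet_derivative g (at x) y) + prod (frechet_derivative f (at x) y) (g x))) (at x)"
      by (intro FDERIV Ck_on_SucD[OF \<open>open S\<close> Suc.prems(1) \<open>x \<in> S\<close>]
          Ck_on_SucD[OF \<open>open S\<close> Suc.prems(2) \<open>x \<in> S\<close>])
  next
    fix b :: 'd assume b: "b \<in> Basis"
    show "Ck_on n S (\<lambda>x. prod (f x) (frechet_derivative g (at x) b) + prod (frechet_derivative f (at x) b) (g x))"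
      using Suc b \<open>open S\<close> by (intro Ck_on_add Suc.IH) (auto intro: Ck_on_Suc_imp simp del: Ck_on.simps, auto)
  qed
qed

lemmas Ck_on_mult = bounded_bilinear.Ck_on[OF bounded_bilinear_mult]
lemmas Ck_on_scaleR = bounded_bilinear.Ck_on[OF bounded_bilinear_scaleR]

lemma Ck_on_prod:
  fixes f :: "'i \<Rightarrow> 'a::euclidean_space \<Rightarrow> 'b::real_normed_field"
  shows "open S \<Longrightarrow> (\<And>i. i \<in> I \<Longrightarrow> Ck_on n S (f i)) \<Longrightarrow> Ck_on n S (\<lambda>x. \<Prod>i\<in>I. f i x)"
  by (induction I rule: infinite_finite_induct) (auto intro: Ck_on_mult)

text \<open>The derivative of \<open>inverse (f x)\<close> is expressed through
  \<open>inverse (f x)\<close> itself, so each order gained feeds the next.\<close>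

lemma Ck_on_inverse:
  fixes f :: "'a::euclidean_space \<Rightarrow> 'b::real_normed_field"
  assumes "open S" "Ck_on n S f" "\<And>x. x \<in> S \<Longrightarrow> f x \<noteq> 0"
  shows "Ck_on n S (\<lambda>x. inverse (f x))"
  using assms(2)
proof (induction n)
  case 0
  then show ?case by (simp add: assms(3) continuous_on_inverse)
next
  case (Suc n)
  note inv = Suc.IH[OF Ck_on_Suc_imp[OF \<open>open S\<close> Suc.prems]]
  show ?case
  proof (rule Ck_on_SucI[OF \<open>open S\<close>])
    fix x assume "x \<in> S"
    show "((\<lambda>x. inverse (f x)) has_derivative
      (\<lambda>y. - (inverse (f x) * frechet_derivative f (at x) y * inverse (f x)))) (at x)"
      by (rule Deriv.has_derivative_inverse[OF assms(3)[OF \<open>x \<in> S\<close>]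
            Ck_on_SucD[OF \<open>open S\<close> Suc.prems \<open>x \<in> S\<close>]])
  qed (use inv \<open>open S\<close> Suc.prems in \<open>auto intro!: Ck_on_minus Ck_on_mult\<close>)
qed

lemma Ck_on_divide:
  fixes f g :: "'a::euclidean_space \<Rightarrow> 'b::real_normed_field"
  assumes "open S" "Ck_on n S f" "Ck_on n S g" "\<And>x. x \<in> S \<Longrightarrow> g x \<noteq> 0"
  shows "Ck_on n S (\<lambda>x. f x / g x)"
  unfolding divide_inverse by (intro Ck_on_mult Ck_on_inverse assms)

lemma linear_sum_Basis:
  fixes h :: "'a::euclidean_space \<Rightarrow> 'b::real_normed_vector"
  assumes "linear h"
  shows "h x = (\<Sum>b\<in>Basis. (x \<bullet> b) *\<^sub>R h b)"
  by (metis (no_types, lifting) assms euclidean_representation linear_scale linear_sum sum.cong)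

text \<open>Expanding the derivative of \<open>g\<close> over the basis turns the chain rule into a
  sum of products: components of the derivative of \<open>f\<close>, times partial derivatives of
  \<open>g\<close> composed with \<open>f\<close>. The induction hypothesis applies to the latter,
  hence \<open>g\<close> is generalised and \<open>f\<close> kept fixed.\<close>

lemma Ck_on_compose:
  fixes f :: "'a::euclidean_space \<Rightarrow> 'b::euclidean_space" and g :: "'b \<Rightarrow> 'c::real_normed_vector"
  assumes "open S" "open T" "f ` S \<subseteq> T" "Ck_on n S f" "Ck_on n T g"
  shows "Ck_on n S (\<lambda>x. g (f x))"
  using assms(4,5)
proof (induction n arbitrary: g)
  case 0
  then show ?case using assms(3) by (auto intro: continuous_on_compose2)
next
  case (Suc n)
  have fx: "f x \<in> T" if "x \<in> S" for x using that assms(3) by blast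
  show ?case
  proof (rule Ck_on_SucI[OF \<open>open S\<close>])
    fix x assume "x \<in> S"
    note dg = Ck_on_SucD[OF \<open>open T\<close> Suc.prems(2) fx[OF \<open>x \<in> S\<close>]]
    have "((\<lambda>x. g (f x)) has_derivative
      (\<lambda>y. frechet_derivative g (at (f x)) (frechet_derivative f (at x) y))) (at x)"
      by (rule has_derivative_compose[OF Ck_on_SucD[OF \<open>open S\<close> Suc.prems(1) \<open>x \<in> S\<close>] dg])
    moreover have "frechet_derivative g (at (f x)) (frechet_derivative f (at x) y) =
      (\<Sum>c\<in>Basis. (frechet_derivative f (at x) y \<bullet> c) *\<^sub>R frechet_derivative g (at (f x)) c)" for y
      by (rule linear_sum_Basis[OF has_derivative_linear[OF dg]])
    ultimately show "((\<lambda>x. g (f x)) has_derivative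
      (\<lambda>y. \<Sum>c\<in>Basis. (frechet_derivative f (at x) y \<bullet> c) *\<^sub>R frechet_derivative g (at (f x)) c)) (at x)"
      by simp
  next
    fix b :: 'a assume b: "b \<in> Basis"
    have 1: "Ck_on n S (\<lambda>x. frechet_derivative g (at (f x)) c)" if "c \<in> Basis" for c
      using Suc.prems that \<open>open S\<close>
      by (intro Suc.IH[of "\<lambda>z. frechet_derivative g (at z) c"]) (auto intro: Ck_on_Suc_imp simp del: Ck_on.simps, auto)
    show "Ck_on n S (\<lambda>x. \<Sum>c\<in>Basis. (frechet_derivative f (at x) b \<bullet> c) *\<^sub>R frechet_derivative g (at (f x)) c)"
      using Suc.prems b \<open>open S\<close> 1
      by (intro Ck_on_sum Ck_on_scaleR Ck_on_bounded_linear_compose[OF bounded_linear_inner_left]) auto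
  qed
qed

section \<open>Partial derivatives\<close>

text \<open>Walk from \<open>x\<close> to \<open>x + h\<close> one coordinate at a time and apply
  the mean value inequality on each leg.\<close>

lemma has_derivative_of_continuous_partials:
  fixes f :: "'a::euclidean_space \<Rightarrow> 'b::real_normed_vector"
  assumes "open S" "x \<in> S"
    and D: "\<And>b y. b \<in> Basis \<Longrightarrow> y \<in> S \<Longrightarrow> ((\<lambda>t. f (y + t *\<^sub>R b)) has_vector_derivative D b y) (at 0)"
    and cont: "\<And>b. b \<in> Basis \<Longrightarrow> continuous_on S (D b)"
  shows "(f has_derivative (\<lambda>h. \<Sum>b\<in>Basis. (h \<bullet> b) *\<^sub>R D b x)) (at x)"
  unfolding has_derivative_at_alt
proof (intro conjI allI impI)
  show "bounded_linear (\<lambda>h. \<Sum>b\<in>Basis. (h \<bullet> b) *\<^sub>R D b x)"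
    by (intro bounded_linear_sum bounded_linear_scaleR_const bounded_linear_inner_left)
next
  fix e :: real assume "e > 0"
  \<comment> \<open>There are \<open>DIM('a)\<close> legs, each with an error of at most
    \<open>\<epsilon> * norm h\<close>.\<close>
  define \<epsilon> where "\<epsilon> = e / DIM('a)"
  have "\<epsilon> > 0" using \<open>e > 0\<close> by (simp add: \<epsilon>_def)
  have "\<forall>\<^sub>F y in at x. y \<in> S \<and> (\<forall>b\<in>Basis. dist (D b y) (D b x) < \<epsilon>)"
  proof (intro eventually_conj eventually_ball_finite ballI)
    show "\<forall>\<^sub>F y in at x. y \<in> S"
      using assms(1,2) by (simp add: eventually_at_topological) blast
    fix b :: 'a assume "b \<in> Basis"
    with cont assms(1,2) have "isCont (D b) x"
      by (simp add: continuous_on_eq_continuous_at)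
    then show "\<forall>\<^sub>F y in at x. dist (D b y) (D b x) < \<epsilon>"
      using \<open>\<epsilon> > 0\<close> by (auto simp: isCont_def intro: tendstoD)
  qed simp
  then obtain \<delta> where "\<delta> > 0" and \<delta>': "\<And>y. y \<noteq> x \<Longrightarrow> dist y x < \<delta> \<Longrightarrow>
      y \<in> S \<and> (\<forall>b\<in>Basis. dist (D b y) (D b x) < \<epsilon>)"
    unfolding eventually_at by auto
  have \<delta>: "y \<in> S" "\<And>b. b \<in> Basis \<Longrightarrow> norm (D b y - D b x) \<le> \<epsilon>" if "dist y x < \<delta>" for y
    using \<delta>'[of y] that \<open>x \<in> S\<close> \<open>\<epsilon> > 0\<close> by (cases "y = x"; force simp: dist_norm)+
  \<comment> \<open>\<open>B\<close> is the set of coordinates already moved;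
    \<open>B = Basis\<close> gives the claim.\<close>
  have main: "norm (f (x + (\<Sum>b\<in>B. (h \<bullet> b) *\<^sub>R b)) - f x - (\<Sum>b\<in>B. (h \<bullet> b) *\<^sub>R D b x))
      \<le> card B * \<epsilon> * norm h" if "norm h < \<delta>" "B \<subseteq> Basis" for h B
    using finite_subset[OF that(2) finite_Basis] that(2)
  proof (induction B rule: finite_induct)
    case empty
    then show ?case by simp
  next
    case (insert c B)
    then have c: "c \<in> Basis" and B: "B \<subseteq> Basis" by auto
    define z where "z = x + (\<Sum>b\<in>B. (h \<bullet> b) *\<^sub>R b)"
    define s where "s = h \<bullet> c"
    \<comment> \<open>Every point of the leg differs from \<open>x\<close> by a vector whose
      components are bounded by those of \<open>h\<close>.\<close>
    have near: "dist (z + t *\<^sub>R c) x < \<delta>" if t: "t \<in> closed_segment 0 s" for t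
    proof -
      from t have ts: "\<bar>t\<bar> \<le> \<bar>s\<bar>" by (auto simp: closed_segment_eq_real_ivl split: if_splits)
      have "norm ((\<Sum>b\<in>B. (h \<bullet> b) *\<^sub>R b) + t *\<^sub>R c) \<le> norm h"
      proof (rule norm_le_componentwise)
        fix b :: 'a assume b: "b \<in> Basis"
        have "(\<Sum>b\<in>B. (h \<bullet> b) *\<^sub>R b) \<bullet> b = (\<Sum>b'\<in>B. if b' = b then h \<bullet> b else 0)"
          unfolding inner_sum_left using B b by (intro sum.cong) (auto simp: inner_Basis)
        also have "\<dots> = (if b \<in> B then h \<bullet> b else 0)"
          using insert.hyps by simp
        finally show "\<bar>((\<Sum>b\<in>B. (h \<bullet> b) *\<^sub>R b) + t *\<^sub>R c) \<bullet> b\<bar> \<le> \<bar>h \<bullet> b\<bar>"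
          using insert.hyps ts c b by (auto simp: inner_add_left inner_Basis s_def)
      qed
      then show ?thesis using \<open>norm h < \<delta>\<close> by (simp add: z_def dist_norm)
    qed
    \<comment> \<open>Subtracting the expected linear part leaves a function whose derivative is the
      oscillation of \<open>D c\<close>, at most \<open>\<epsilon>\<close>.\<close>
    let ?\<phi> = "\<lambda>t. f (z + t *\<^sub>R c) - t *\<^sub>R D c x"
    have "norm (?\<phi> s - ?\<phi> 0) \<le> \<epsilon> * norm (s - 0)"
    proof (rule differentiable_bound)
      show "convex (closed_segment 0 s)" by simp
      fix t assume t: "t \<in> closed_segment 0 s"
      \<comment> \<open>\<open>D\<close> gives derivatives at parameter \<open>0\<close> only, so
        the base point is moved to \<open>z + t *\<^sub>R c\<close>; writing \<open>0\<close> as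
        \<open>t - t\<close> prepares the shift by the chain rule.\<close>
      have "((\<lambda>u. f ((z + t *\<^sub>R c) + u *\<^sub>R c)) has_vector_derivative D c (z + t *\<^sub>R c)) (at (t - t))"
        using D[OF c \<delta>(1)[OF near[OF t]]] by simp
      then have "((\<lambda>u. f ((z + t *\<^sub>R c) + u *\<^sub>R c)) \<circ> (\<lambda>u. u - t) has_vector_derivative 1 *\<^sub>R D c (z + t *\<^sub>R c)) (at t)"
        by (intro vector_diff_chain_at) (auto intro!: derivative_eq_intros)
      then have "((\<lambda>u. f (z + u *\<^sub>R c)) has_vector_derivative D c (z + t *\<^sub>R c)) (at t)"
        by (simp add: o_def algebra_simps flip: scaleR_add_left)
      then have "(?\<phi> has_vector_derivative D c (z + t *\<^sub>R c) - D c x) (at t)"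
        by (auto intro!: derivative_eq_intros)
      then show "(?\<phi> has_derivative (\<lambda>u. u *\<^sub>R (D c (z + t *\<^sub>R c) - D c x))) (at t within closed_segment 0 s)"
        by (simp add: has_vector_derivative_def has_derivative_at_withinI)
      have "norm (u *\<^sub>R (D c (z + t *\<^sub>R c) - D c x)) \<le> \<epsilon> * norm u" for u
        using mult_left_mono[OF \<delta>(2)[OF near[OF t] c], of "\<bar>u\<bar>"] by (simp add: mult.commute)
      then show "onorm (\<lambda>u. u *\<^sub>R (D c (z + t *\<^sub>R c) - D c x)) \<le> \<epsilon>"
        by (rule onorm_le)
    qed auto
    also have "\<dots> \<le> \<epsilon> * norm h"
      using \<open>\<epsilon> > 0\<close> Basis_le_norm[OF c, of h] by (simp add: s_def)
    finally have 1: "norm (f (z + s *\<^sub>R c) - f z - s *\<^sub>R D c x) \<le> \<epsilon> * norm h"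
      by (simp add: algebra_simps)
    have 2: "norm (f z - f x - (\<Sum>b\<in>B. (h \<bullet> b) *\<^sub>R D b x)) \<le> card B * \<epsilon> * norm h"
      using insert.IH[OF B] by (simp add: z_def)
    have z_eq: "x + (\<Sum>b\<in>insert c B. (h \<bullet> b) *\<^sub>R b) = z + s *\<^sub>R c"
      using insert.hyps by (simp add: z_def s_def ac_simps)
    have "f (x + (\<Sum>b\<in>insert c B. (h \<bullet> b) *\<^sub>R b)) - f x - (\<Sum>b\<in>insert c B. (h \<bullet> b) *\<^sub>R D b x) =
       (f (z + s *\<^sub>R c) - f z - s *\<^sub>R D c x) + (f z - f x - (\<Sum>b\<in>B. (h \<bullet> b) *\<^sub>R D b x))"
      unfolding z_eq using insert.hyps by (simp add: s_def)
    also have "norm \<dots> \<le> \<epsilon> * norm h + card B * \<epsilon> * norm h"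
      by (rule norm_triangle_mono[OF 1 2])
    also have "\<dots> = card (insert c B) * \<epsilon> * norm h"
      using insert.hyps by (simp add: algebra_simps)
    finally show ?case .
  qed
  show "\<exists>d>0. \<forall>y. norm (y - x) < d \<longrightarrow>
      norm (f y - f x - (\<Sum>b\<in>Basis. ((y - x) \<bullet> b) *\<^sub>R D b x)) \<le> e * norm (y - x)"
  proof (intro exI[of _ \<delta>] conjI allI impI)
    fix y assume "norm (y - x) < \<delta>"
    from main[OF this order.refl]
    show "norm (f y - f x - (\<Sum>b\<in>Basis. ((y - x) \<bullet> b) *\<^sub>R D b x)) \<le> e * norm (y - x)"
      by (simp add: euclidean_representation \<epsilon>_def)
  qed fact
qed

lemma partials_snoc: "partials (w @ [i]) f = partials w (partial i f)"
  by (induction w) auto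

lemma Cp_on_0: "Cp_on 0 \<Omega> f \<longleftrightarrow> continuous_on \<Omega> f"
  by (auto simp: Cp_on_def zero_enat_def)

text \<open>Words are split at their last letter, which is the derivative taken first. What remains
  are conditions on \<open>partial i f\<close>, as induction on the order requires.\<close>

lemma Cp_on_Suc:
  "Cp_on (enat (Suc n)) \<Omega> f \<longleftrightarrow> continuous_on \<Omega> f \<and>
     (\<forall>i. \<forall>x\<in>\<Omega>. (\<lambda>t. f (x + t *\<^sub>R axis i 1)) differentiable (at 0)) \<and>
     (\<forall>i. Cp_on (enat n) \<Omega> (partial i f))"
proof -
  have all_words: "(\<forall>w::'a list. P w) \<longleftrightarrow> P [] \<and> (\<forall>i w. P (w @ [i]))" for P
    by (metis rev_exhaust)
  show ?thesis
    unfolding Cp_on_def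
    by (subst (1) all_words, subst (2) all_words) (auto simp: partials_snoc)
qed

text \<open>Reduces infinite \<open>p\<close> to finite orders, where induction is
  available.\<close>

lemma Cp_on_iff_enat: "Cp_on p \<Omega> f \<longleftrightarrow> (\<forall>n. enat n \<le> p \<longrightarrow> Cp_on (enat n) \<Omega> f)"
proof
  assume "Cp_on p \<Omega> f"
  then show "\<forall>n. enat n \<le> p \<longrightarrow> Cp_on (enat n) \<Omega> f"
    unfolding Cp_on_def by (meson order_trans less_le_trans)
next
  assume *: "\<forall>n. enat n \<le> p \<longrightarrow> Cp_on (enat n) \<Omega> f"
  have "continuous_on \<Omega> (partials w f)" if "enat (length w) \<le> p" for w
    using *[rule_format, OF that] by (auto simp: Cp_on_def)
  moreover have "(\<lambda>t. partials w f (x + t *\<^sub>R axis i 1)) differentiable (at 0)"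
    if "enat (length w) < p" "x \<in> \<Omega>" for w i x
    using *[rule_format, of "Suc (length w)"] that by (auto simp: Cp_on_def Suc_ile_eq)
  ultimately show "Cp_on p \<Omega> f" unfolding Cp_on_def by blast
qed

lemma has_vector_derivative_along:
  assumes "(f has_derivative f') (at x)"
  shows "((\<lambda>t. f (x + t *\<^sub>R b)) has_vector_derivative f' b) (at 0)"
proof -
  have "((\<lambda>t. x + t *\<^sub>R b) has_derivative (\<lambda>t. t *\<^sub>R b)) (at 0)"
    by (auto intro!: derivative_eq_intros)
  then have "((\<lambda>t. f (x + t *\<^sub>R b)) has_derivative (\<lambda>t. f' (t *\<^sub>R b))) (at 0)"
    by (rule has_derivative_compose) (use assms in simp)
  then show ?thesis
    using has_derivative_linear[OF assms]
    by (simp add: has_vector_derivative_def linear_scale)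
qed

lemma partial_eq_derivative:
  "(f has_derivative f') (at x) \<Longrightarrow> partial i f x = f' (axis i 1)"
  unfolding partial_def by (intro vector_derivative_at has_vector_derivative_along)

text \<open>From left to right, the first partial derivatives are \<open>Ck_on n\<close> by
  induction, hence continuous, and this yields a total derivative. Conversely, the total derivative
  is evaluated along the axes.\<close>

lemma Cp_on_enat_iff_Ck_on:
  fixes f :: "real^'d \<Rightarrow> 'k::real_normed_field"
  assumes "open \<Omega>"
  shows "Cp_on (enat n) \<Omega> f \<longleftrightarrow> Ck_on n \<Omega> f"
proof (induction n arbitrary: f)
  case 0
  then show ?case by (simp add: Cp_on_0 flip: zero_enat_def)
next
  case (Suc n)
  show ?case
  proof
    assume "Cp_on (enat (Suc n)) \<Omega> f"
    then have diff: "\<And>i x. x \<in> \<Omega> \<Longrightarrow> (\<lambda>t. f (x + t *\<^sub>R axis i 1)) differentiable (at 0)"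
      and Ck: "\<And>i. Ck_on n \<Omega> (partial i f)"
      by (auto simp: Cp_on_Suc Suc.IH)
    define D where "D b x = vector_derivative (\<lambda>t. f (x + t *\<^sub>R b)) (at 0)" for b x
    have D_axis: "D (axis i 1) = partial i f" for i
      by (auto simp: D_def partial_def)
    show "Ck_on (Suc n) \<Omega> f"
    proof (rule Ck_on_SucI[OF \<open>open \<Omega>\<close>])
      fix x assume "x \<in> \<Omega>"
      show "(f has_derivative (\<lambda>h. \<Sum>b\<in>Basis. (h \<bullet> b) *\<^sub>R D b x)) (at x)"
      proof (rule has_derivative_of_continuous_partials[OF \<open>open \<Omega>\<close> \<open>x \<in> \<Omega>\<close>])
        fix b :: "real^'d" and y assume "b \<in> Basis" "y \<in> \<Omega>"
        then show "((\<lambda>t. f (y + t *\<^sub>R b)) has_vector_derivative D b y) (at 0)"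
          using diff by (auto simp: D_def Basis_vec_def simp flip: vector_derivative_works)
      next
        fix b :: "real^'d" assume "b \<in> Basis"
        then show "continuous_on \<Omega> (D b)"
          using Ck_on_imp_continuous_on[OF \<open>open \<Omega>\<close> Ck] by (auto simp: Basis_vec_def D_axis)
      qed
    next
      fix b :: "real^'d" assume "b \<in> Basis"
      then obtain i where b: "b = axis i 1" by (auto simp: Basis_vec_def)
      have "(\<Sum>b'\<in>Basis. (b \<bullet> b') *\<^sub>R D b' x) = (\<Sum>b'\<in>Basis. if b' = b then D b x else 0)" for x
        using \<open>b \<in> Basis\<close> by (intro sum.cong) (auto simp: inner_Basis)
      then have "(\<Sum>b'\<in>Basis. (b \<bullet> b') *\<^sub>R D b' x) = partial i f x" for x
        using \<open>b \<in> Basis\<close> by (simp add: b D_axis)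
      then show "Ck_on n \<Omega> (\<lambda>x. \<Sum>b'\<in>Basis. (b \<bullet> b') *\<^sub>R D b' x)"
        using Ck by simp
    qed
  next
    assume Ck: "Ck_on (Suc n) \<Omega> f"
    note der = Ck_on_SucD[OF \<open>open \<Omega>\<close> Ck]
    have "Ck_on n \<Omega> (partial i f)" for i
    proof (rule Ck_on_cong_imp[OF \<open>open \<Omega>\<close>])
      show "Ck_on n \<Omega> (\<lambda>x. frechet_derivative f (at x) (axis i 1))"
        using Ck by (auto simp: Basis_vec_def)
    qed (simp add: partial_eq_derivative[OF der])
    moreover have "(\<lambda>t. f (x + t *\<^sub>R axis i 1)) differentiable (at 0)" if "x \<in> \<Omega>" for x i
      using has_vector_derivative_along[OF der[OF that]] by (rule differentiableI_vector)
    ultimately show "Cp_on (enat (Suc n)) \<Omega> f"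
      using Ck_on_imp_continuous_on[OF \<open>open \<Omega>\<close> Ck] by (simp add: Cp_on_Suc Suc.IH)
  qed
qed

lemma Cp_on_iff_Ck_on:
  fixes f :: "real^'d \<Rightarrow> 'k::real_normed_field"
  shows "open \<Omega> \<Longrightarrow> Cp_on p \<Omega> f \<longleftrightarrow> (\<forall>n. enat n \<le> p \<longrightarrow> Ck_on n \<Omega> f)"
  using Cp_on_iff_enat[of p \<Omega> f] by (simp add: Cp_on_enat_iff_Ck_on)

lemma partials_cong_open:
  assumes "open U" "\<And>x. x \<in> U \<Longrightarrow> f x = g x" "x \<in> U"
  shows "partials w f x = partials w g x"
  using assms(3)
proof (induction w arbitrary: x)
  case Nil
  then show ?case using assms(2) by simp
next
  case (Cons i w)
  have "((\<lambda>t. x + t *\<^sub>R axis i 1) \<longlongrightarrow> x + 0 *\<^sub>R axis i 1) (nhds 0)"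
    by (intro tendsto_intros filterlim_ident)
  then have "\<forall>\<^sub>F t in nhds 0. x + t *\<^sub>R axis i 1 \<in> U"
    by (rule topological_tendstoD[OF _ \<open>open U\<close>]) (use Cons.prems in simp)
  then have "vector_derivative (\<lambda>t. partials w f (x + t *\<^sub>R axis i 1)) (at 0)
      = vector_derivative (\<lambda>t. partials w g (x + t *\<^sub>R axis i 1)) (at 0)"
    by (intro vector_derivative_cong_eq) (auto elim!: eventually_mono simp: Cons.IH)
  then show ?case by (simp add: partial_def)
qed

section \<open>Smooth cutoff functions\<close>

text \<open>\<open>flat 0\<close> is the standard smooth function exp(-1/t) extended by zero. The
  extra powers of 1/t make the linear span of the family closed under differentiation.\<close>

definition flat :: "nat \<Rightarrow> real \<Rightarrow> real" where
  "flat k t = (if t > 0 then exp (- inverse t) * inverse t ^ k else 0)"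

lemma flat_nonneg: "flat k t \<ge> 0"
  by (simp add: flat_def)

lemma flat_eq_0_iff: "flat k t = 0 \<longleftrightarrow> t \<le> 0"
  by (simp add: flat_def)

lemma tendsto_flat_0: "(flat k \<longlongrightarrow> 0) (at 0)"
proof -
  have "((\<lambda>t. inverse t ^ k / exp (inverse t)) \<longlongrightarrow> 0) (at_right (0::real))"
    by (rule filterlim_compose[OF tendsto_power_div_exp_0 filterlim_inverse_at_top_right])
  moreover have "\<forall>\<^sub>F t in at_right 0. inverse t ^ k / exp (inverse t) = flat k t"
    using eventually_at_right_less[of 0]
    by eventually_elim (simp add: flat_def exp_minus divide_inverse mult.commute)
  ultimately have "(flat k \<longlongrightarrow> 0) (at_right 0)"
    by (rule Lim_transform_eventually)
  moreover have "(flat k \<longlongrightarrow> 0) (at_left 0)"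
  proof (rule Lim_transform_eventually[OF tendsto_const])
    have "\<forall>\<^sub>F t in at_left (0::real). t < 0" by (auto simp: eventually_at_filter)
    then show "\<forall>\<^sub>F t in at_left 0. 0 = flat k t"
      by eventually_elim (simp add: flat_def)
  qed
  ultimately show ?thesis by (simp add: filterlim_at_split)
qed

lemma has_derivative_flat:
  "(flat k has_real_derivative flat (k + 2) t - real k * flat (k + 1) t) (at t)"
proof -
  consider "t > 0" | "t < 0" | "t = 0" by linarith
  then show ?thesis
  proof cases
    case 1
    have "((\<lambda>t. exp (- inverse t) * inverse t ^ k) has_real_derivative
       flat (k + 2) t - real k * flat (k + 1) t) (at t)"
      using 1 by (auto intro!: derivative_eq_intros simp: flat_def)
        (cases k; simp add: power2_eq_square algebra_simps)
    then show ?thesis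
      by (rule has_field_derivative_transform_within_open[of _ _ _ "{0<..}"])
         (use 1 in \<open>auto simp: flat_def\<close>)
  next
    case 2
    have "((\<lambda>t. 0) has_real_derivative flat (k + 2) t - real k * flat (k + 1) t) (at t)"
      using 2 by (simp add: flat_def)
    then show ?thesis
      by (rule has_field_derivative_transform_within_open[of _ _ _ "{..<0}"])
         (use 2 in \<open>auto simp: flat_def\<close>)
  next
    case 3
    \<comment> \<open>The difference quotient of \<open>flat k\<close> at \<open>0\<close> is
      \<open>flat (Suc k)\<close>.\<close>
    have "((\<lambda>h. (flat k (0 + h) - flat k 0) / h) \<longlongrightarrow> 0) (at 0)"
      by (rule Lim_transform_eventually[OF tendsto_flat_0[of "Suc k"]])
         (auto simp: flat_def divide_inverse eventually_at_filter)
    then have "(flat k has_real_derivative 0) (at 0)"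
      by (simp add: DERIV_def)
    then show ?thesis by (simp add: 3 flat_def)
  qed
qed

lemma Ck_on_flat: "Ck_on n UNIV (flat k)"
proof (induction n arbitrary: k)
  case 0
  show ?case
    using has_derivative_flat[THEN DERIV_isCont] by (simp add: continuous_at_imp_continuous_on)
next
  case (Suc n)
  show ?case
  proof (rule Ck_on_SucI)
    fix t :: real
    show "(flat k has_derivative (\<lambda>h. (flat (k + 2) t - real k * flat (k + 1) t) * h)) (at t)"
      using has_derivative_flat[of k t] by (simp add: has_field_derivative_def)
  qed (intro Ck_on_mult Ck_on_diff Ck_on_const Suc.IH open_UNIV)+
qed

text \<open>The cutoff equals 1 on a neighbourhood \<open>U\<close> of \<open>K\<close> and not
  merely on \<open>K\<close>, so that multiplying by it leaves derivatives on \<open>K\<close>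
  unchanged. A sum \<open>\<Phi>\<close> of bumps over a finite cover by balls is positive on
  \<open>K\<close>; composing it with a smooth step makes it constant there.\<close>

lemma smooth_cutoff:
  fixes K :: "'a::euclidean_space set"
  assumes "compact K" "open S" "K \<subseteq> S"
  obtains \<kappa> :: "'a \<Rightarrow> real" and L U where
    "compact L" "L \<subseteq> S" "open U" "K \<subseteq> U"
    "\<And>x. x \<in> U \<Longrightarrow> \<kappa> x = 1" "\<And>x. x \<notin> L \<Longrightarrow> \<kappa> x = 0" "\<And>n. Ck_on n UNIV \<kappa>"
proof -
  have "\<forall>x\<in>K. \<exists>r>0. cball x r \<subseteq> S"
    using assms by (meson open_contains_cball subsetD)
  then obtain r where r: "\<And>x. x \<in> K \<Longrightarrow> r x > 0" "\<And>x. x \<in> K \<Longrightarrow> cball x (r x) \<subseteq> S"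
    by metis
  have "K \<subseteq> (\<Union>x\<in>K. ball x (r x))" using r(1) by force
  then obtain C where C: "C \<subseteq> K" "finite C" "K \<subseteq> (\<Union>x\<in>C. ball x (r x))"
    using compactE_image[OF \<open>compact K\<close>, of K "\<lambda>x. ball x (r x)"] by auto
  define \<Phi> where "\<Phi> x = (\<Sum>c\<in>C. flat 0 ((r c)\<^sup>2 - (x - c) \<bullet> (x - c)))" for x
  have "Ck_on n UNIV (\<lambda>x. (r c)\<^sup>2 - (x - c) \<bullet> (x - c))" for n c
    by (intro Ck_on_diff bounded_bilinear.Ck_on[OF bounded_bilinear_inner] Ck_on_const Ck_on_id open_UNIV)
  then have Ck_\<Phi>: "Ck_on n UNIV \<Phi>" for n
    unfolding \<Phi>_def by (intro Ck_on_sum Ck_on_compose[OF _ _ _ _ Ck_on_flat] open_UNIV) auto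
  then have cont_\<Phi>: "continuous_on UNIV \<Phi>" by (rule Ck_on_imp_continuous_on[OF open_UNIV])
  have \<Phi>_pos: "\<Phi> x > 0 \<longleftrightarrow> x \<in> (\<Union>c\<in>C. ball c (r c))" and \<Phi>_nonneg: "\<Phi> x \<ge> 0" for x
  proof -
    have *: "(r c)\<^sup>2 - (x - c) \<bullet> (x - c) > 0 \<longleftrightarrow> x \<in> ball c (r c)" if "c \<in> C" for c
    proof -
      have "r c > 0" using r(1) C(1) that by blast
      then have "norm (x - c) < r c \<longleftrightarrow> (norm (x - c))\<^sup>2 < (r c)\<^sup>2"
        using abs_le_square_iff[of "r c" "norm (x - c)"] by (simp flip: not_le)
      then show ?thesis
        by (simp add: dist_norm norm_minus_commute flip: power2_norm_eq_inner)
    qed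
    show "\<Phi> x \<ge> 0" by (simp add: \<Phi>_def sum_nonneg flat_nonneg)
    then have "\<Phi> x > 0 \<longleftrightarrow> \<Phi> x \<noteq> 0" by auto
    also have "\<dots> \<longleftrightarrow> (\<exists>c\<in>C. flat 0 ((r c)\<^sup>2 - (x - c) \<bullet> (x - c)) \<noteq> 0)"
      unfolding \<Phi>_def by (subst sum_nonneg_eq_0_iff) (auto simp: C flat_nonneg)
    finally show "\<Phi> x > 0 \<longleftrightarrow> x \<in> (\<Union>c\<in>C. ball c (r c))"
      using * by (auto simp: flat_eq_0_iff not_le)
  qed
  obtain m where m: "m > 0" "\<And>x. x \<in> K \<Longrightarrow> \<Phi> x > m"
  proof (cases "K = {}")
    case True
    then show ?thesis using that[of 1] by simp
  next
    case False
    obtain x0 where "x0 \<in> K" and x0: "\<forall>x\<in>K. \<Phi> x0 \<le> \<Phi> x"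
      using continuous_attains_inf[OF \<open>compact K\<close> False continuous_on_subset[OF cont_\<Phi>]] by auto
    have "\<Phi> x0 > 0" using \<Phi>_pos C(3) \<open>x0 \<in> K\<close> by blast
    \<comment> \<open>Half of the minimum makes the bound strict, so the open set where
      \<open>\<Phi>\<close> exceeds \<open>m\<close> contains \<open>K\<close>.\<close>
    then show ?thesis using x0 by (intro that[of "\<Phi> x0 / 2"]) force+
  qed
  \<comment> \<open>A smooth step: 0 for \<open>t \<le> 0\<close> and 1 for
    \<open>t \<ge> m\<close>. The denominator never vanishes because \<open>m > 0\<close>.\<close>
  define h where "h t = flat 0 t / (flat 0 t + flat 0 (m - t))" for t
  have den: "flat 0 t + flat 0 (m - t) \<noteq> 0" for t
    using m(1) flat_nonneg[of 0 t] flat_nonneg[of 0 "m - t"]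
    by (auto simp: add_nonneg_eq_0_iff flat_eq_0_iff)
  have "Ck_on n UNIV (\<lambda>t. flat 0 (m - t))" for n
    by (intro Ck_on_compose[OF _ _ _ _ Ck_on_flat] Ck_on_diff) auto
  then have Ck_h: "Ck_on n UNIV h" for n
    unfolding h_def by (intro Ck_on_divide Ck_on_add Ck_on_flat den open_UNIV) auto
  show ?thesis
  proof (rule that[of "\<Union>c\<in>C. cball c (r c)" "{x. m < \<Phi> x}" "\<lambda>x. h (\<Phi> x)"])
    show "compact (\<Union>c\<in>C. cball c (r c))" using C(2) by auto
    show "(\<Union>c\<in>C. cball c (r c)) \<subseteq> S" using r(2) C(1) by blast
    show "open {x. m < \<Phi> x}" by (rule open_Collect_less) (simp_all add: cont_\<Phi>)
    show "K \<subseteq> {x. m < \<Phi> x}" using m(2) by auto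
    show "h (\<Phi> x) = 1" if "x \<in> {x. m < \<Phi> x}" for x
      using that m(1) by (auto simp: h_def flat_def)
    show "h (\<Phi> x) = 0" if "x \<notin> (\<Union>c\<in>C. cball c (r c))" for x
    proof -
      have "\<not> \<Phi> x > 0" using that unfolding \<Phi>_pos by force
      then show ?thesis by (simp add: h_def flat_def)
    qed
    show "Ck_on n UNIV (\<lambda>x. h (\<Phi> x))" for n
      by (rule Ck_on_compose[OF _ _ _ Ck_\<Phi> Ck_h]) auto
  qed
qed

section \<open>The inverse function\<close>

lemma Ck_on_vec:
  fixes f :: "'a::euclidean_space \<Rightarrow> real^'d"
  assumes "open S" "\<And>k. Ck_on n S (\<lambda>x. f x $ k)"
  shows "Ck_on n S f"
proof -
  have "f = (\<lambda>x. \<Sum>k\<in>UNIV. f x $ k *\<^sub>R axis k 1)"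
    by (rule ext) (simp add: basis_expansion flip: scalar_mult_eq_scaleR)
  moreover have "Ck_on n S (\<lambda>x. \<Sum>k\<in>UNIV. f x $ k *\<^sub>R axis k (1::real))"
    by (intro Ck_on_sum Ck_on_scaleR assms Ck_on_const)
  ultimately show ?thesis by simp
qed

lemma Ck_on_vec_nth: "open S \<Longrightarrow> Ck_on n S f \<Longrightarrow> Ck_on n S (\<lambda>x. f x $ k)"
  by (rule Ck_on_bounded_linear_compose[OF bounded_linear_vec_nth])

lemma Ck_on_det:
  fixes M :: "'a::euclidean_space \<Rightarrow> real^'d^'d"
  assumes "open S" "\<And>i j. Ck_on n S (\<lambda>x. M x $ i $ j)"
  shows "Ck_on n S (\<lambda>x. det (M x))"
  unfolding det_def by (intro Ck_on_sum Ck_on_mult Ck_on_prod Ck_on_const assms)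

text \<open>The derivative of the inverse \<open>g\<close> is the inverse matrix of the derivative
  of \<open>f\<close> at \<open>g y\<close>. Cramer's rule writes it with determinants in the
  entries, so it is as regular as \<open>g\<close> and the derivative of \<open>f\<close> allow, and
  the regularity of \<open>g\<close> rises one order at a time.\<close>

lemma Ck_on_inv_into:
  fixes f :: "real^'d \<Rightarrow> real^'d"
  assumes "open S" "inj_on f S" "Ck_on n S f" "n \<ge> 1"
    and inj': "\<And>x v. x \<in> S \<Longrightarrow> frechet_derivative f (at x) v = 0 \<Longrightarrow> v = 0"
  shows "Ck_on n (f ` S) (inv_into S f)"
proof -
  define g where "g = inv_into S f"
  have cont: "continuous_on S f" by (rule Ck_on_imp_continuous_on assms)+
  have open_im: "open (f ` S)" by (rule invariance_of_domain[OF cont \<open>open S\<close> \<open>inj_on f S\<close>])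
  have gf: "g (f x) = x" if "x \<in> S" for x
    using that \<open>inj_on f S\<close> by (simp add: g_def)
  have g_in: "g y \<in> S" and fg: "f (g y) = y" if "y \<in> f ` S" for y
    using that by (auto simp: gf)
  define A where "A y = matrix (frechet_derivative f (at (g y)))" for y
  \<comment> \<open>Cramer's formula for the solution \<open>v\<close> of
    \<open>A y *v v = b\<close>.\<close>
  define G where "G y b = (\<chi> k. det (\<chi> i j. if j = k then b $ i else A y $ i $ j) / det (A y))" for y b
  have der_f: "(f has_derivative frechet_derivative f (at x)) (at x)" if "x \<in> S" for x
    using Ck_on_SucD[OF \<open>open S\<close> _ that, of 0 f] Ck_on_le[OF \<open>open S\<close> assms(3), of 1] \<open>n \<ge> 1\<close> by simp
  have lin: "linear (frechet_derivative f (at x))" if "x \<in> S" for x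
    using der_f[OF that] by (rule has_derivative_linear)
  have A_mult: "A y *v v = frechet_derivative f (at (g y)) v" if "y \<in> f ` S" for y v
    unfolding A_def by (rule matrix_works[OF lin[OF g_in[OF that], folded linear_matrix_vector_mul_eq]])
  have det_A: "det (A y) \<noteq> 0" if "y \<in> f ` S" for y
  proof -
    have "inj (frechet_derivative f (at (g y)))"
      using inj'[OF g_in[OF that]] by (simp add: linear_injective_0[OF lin[OF g_in[OF that]]])
    then show ?thesis
      unfolding A_def by (simp add: det_nz_iff_inj[OF lin[OF g_in[OF that]]])
  qed
  have der_g: "(g has_derivative G y) (at y)" if y: "y \<in> f ` S" for y
  proof -
    have "(g has_derivative G y) (at (f (g y)))"
    proof (rule has_derivative_inverse_strong[OF \<open>open S\<close> g_in[OF y] cont gf der_f[OF g_in[OF y]]])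
      have "A y *v G y b = b" for b
        using cramer[OF det_A[OF y], of "G y b" b] by (simp add: G_def)
      then show "frechet_derivative f (at (g y)) \<circ> G y = id"
        by (auto simp: A_mult[OF y])
    qed
    then show ?thesis by (simp add: fg[OF y])
  qed
  have "m \<le> n \<Longrightarrow> Ck_on m (f ` S) g" for m
  proof (induction m)
    case 0
    show ?case
      using der_g by (auto intro!: continuous_at_imp_continuous_on dest: has_derivative_continuous)
  next
    case (Suc m)
    show ?case
    proof (rule Ck_on_SucI[OF open_im der_g])
      fix b :: "real^'d" assume "b \<in> Basis"
      have f': "Ck_on m S (\<lambda>x. frechet_derivative f (at x) (axis j 1))" for j
        using Ck_on_le[OF \<open>open S\<close> assms(3) \<open>Suc m \<le> n\<close>] by (auto simp: Basis_vec_def)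
      have "Ck_on m (f ` S) (\<lambda>y. frechet_derivative f (at (g y)) (axis j 1) $ i)" for i j
        using Suc g_in by (intro Ck_on_vec_nth[OF open_im] Ck_on_compose[OF open_im \<open>open S\<close> _ _ f']) auto
      then have A: "Ck_on m (f ` S) (\<lambda>y. A y $ i $ j)" for i j
        by (simp add: A_def matrix_def)
      have if_A: "Ck_on m (f ` S) (\<lambda>y. if j = k then b $ i else A y $ i $ j)" for i j k
        using A by (cases "j = k") auto
      show "Ck_on m (f ` S) (\<lambda>y. G y b)"
        unfolding G_def
        by (rule Ck_on_vec[OF open_im])
           (simp only: vec_lambda_beta, intro Ck_on_divide Ck_on_det open_im det_A; simp add: A if_A)
    qed
  qed
  then show ?thesis by (simp add: g_def)
qed

section \<open>The topology of the space\<close>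

lemma Cp_space_iff:
  fixes f :: "real^'d \<Rightarrow> 'k::real_normed_field"
  assumes "open \<Omega>"
  shows "f \<in> Cp_space p \<Omega> \<longleftrightarrow>
    (\<forall>n. enat n \<le> p \<longrightarrow> Ck_on n \<Omega> f) \<and> (\<forall>x. x \<notin> \<Omega> \<longrightarrow> f x = 0)"
  by (simp add: Cp_space_def Cp_on_iff_Ck_on[OF assms])

lemma Cp_space_extend:
  fixes f :: "real^'d \<Rightarrow> 'k::real_normed_field"
  assumes "open \<Omega>" "\<And>n. enat n \<le> p \<Longrightarrow> Ck_on n \<Omega> f"
  shows "(\<lambda>x. if x \<in> \<Omega> then f x else 0) \<in> Cp_space p \<Omega>"
  unfolding Cp_space_iff[OF assms(1)]
  using Ck_on_cong_imp[OF assms(1) assms(2), where g = "\<lambda>x. if x \<in> \<Omega> then f x else 0"] by auto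

lemma Cp_space_diff:
  fixes f g :: "real^'d \<Rightarrow> 'k::real_normed_field"
  shows "open \<Omega> \<Longrightarrow> f \<in> Cp_space p \<Omega> \<Longrightarrow> g \<in> Cp_space p \<Omega> \<Longrightarrow>
    (\<lambda>x. f x - g x) \<in> Cp_space p \<Omega>"
  by (simp add: Cp_space_iff Ck_on_diff)

lemma zero_in_Cp_space:
  "open \<Omega> \<Longrightarrow> (\<lambda>x. 0 :: 'k::real_normed_field) \<in> Cp_space p \<Omega>"
  by (simp add: Cp_space_iff)

lemma finite_words: "finite {w :: 'd::finite list. length w \<le> n}"
  using finite_lists_length_le[of "UNIV :: 'd set" n] by simp

lemma norm_partials_le_Cp_seminorm:
  fixes f :: "real^'d \<Rightarrow> 'k::real_normed_field"
  assumes "f \<in> Cp_space p \<Omega>" "compact K" "K \<subseteq> \<Omega>" "enat n \<le> p" "length w \<le> n" "x \<in> K"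
  shows "norm (partials w f x) \<le> Cp_seminorm K n f"
proof -
  have "enat (length w) \<le> p" using assms(4,5) by (meson enat_ord_simps(1) order_trans)
  then have "continuous_on K (\<lambda>x. norm (partials w f x))"
    using assms(1,3) by (auto simp: Cp_space_def Cp_on_def intro: continuous_on_norm continuous_on_subset)
  then have "bdd_above ((\<lambda>x. norm (partials w f x)) ` K)"
    by (intro bounded_imp_bdd_above compact_imp_bounded compact_continuous_image assms(2))
  then have "norm (partials w f x) \<le> Sup (insert 0 ((\<lambda>x. norm (partials w f x)) ` K))"
    using assms(6) by (intro cSup_upper) auto
  also have "\<dots> \<le> Cp_seminorm K n f"
    unfolding Cp_seminorm_def using assms(5) by (intro Max_ge finite_imageI finite_words) auto
  finally show ?thesis .
qed

lemma partials_zero: "partials w (\<lambda>x. 0) = (\<lambda>x. 0)"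
  by (induction w) (auto simp: partial_def)

lemma Cp_seminorm_zero: "Cp_seminorm K n (\<lambda>x. 0) = 0"
proof -
  have "insert 0 ((\<lambda>x. 0) ` K) = {0::real}" by auto
  then have "Sup (insert 0 ((\<lambda>x. 0) ` K)) = (0::real)" by (simp only: cSup_singleton)
  moreover have "(\<lambda>w::'a list. 0::real) ` {w. length w \<le> n} = {0}"
    by (subst image_constant_conv) (auto intro: exI[of _ "[]"])
  ultimately show ?thesis by (simp only: Cp_seminorm_def partials_zero norm_zero) simp
qed

lemma Cp_seminorm_cong:
  assumes "open V" "K \<subseteq> V" "\<And>x. x \<in> V \<Longrightarrow> f x = g x"
  shows "Cp_seminorm K n f = Cp_seminorm K n g"
proof -
  have "partials w f x = partials w g x" if "x \<in> K" for w x
    using partials_cong_open[of V f g, OF assms(1,3)] that assms(2) by blast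
  then show ?thesis by (simp add: Cp_seminorm_def)
qed

definition Cp_nbhd ::
    "enat \<Rightarrow> (real^'d) set \<Rightarrow> (real^'d \<Rightarrow> 'k::real_normed_field) \<Rightarrow> (real^'d) set \<Rightarrow> nat \<Rightarrow> real
       \<Rightarrow> (real^'d \<Rightarrow> 'k) set" where
  "Cp_nbhd p \<Omega> f K n \<epsilon> = {g \<in> Cp_space p \<Omega>. Cp_seminorm K n (\<lambda>x. g x - f x) < \<epsilon>}"

lemma Cp_nbhd_self:
  "f \<in> Cp_space p \<Omega> \<Longrightarrow> \<epsilon> > 0 \<Longrightarrow> f \<in> Cp_nbhd p \<Omega> f K n \<epsilon>"
  by (simp add: Cp_nbhd_def Cp_seminorm_zero)

lemma openin_Cp_nbhd:
  assumes "f \<in> Cp_space p \<Omega>" "compact K" "K \<subseteq> \<Omega>" "enat n \<le> p" "\<epsilon> > 0"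
  shows "openin (Cp_topology p \<Omega>) (Cp_nbhd p \<Omega> f K n \<epsilon>)"
  unfolding Cp_topology_def
  by (rule topology_generated_by_Basis) (use assms in \<open>auto simp: Cp_nbhd_def\<close>)

lemma topspace_Cp_topology [simp]: "topspace (Cp_topology p \<Omega>) = Cp_space p \<Omega>"
proof
  show "topspace (Cp_topology p \<Omega>) \<subseteq> Cp_space p \<Omega>"
    by (auto simp: Cp_topology_def)
  show "Cp_space p \<Omega> \<subseteq> topspace (Cp_topology p \<Omega>)"
  proof
    fix f assume f: "f \<in> Cp_space p \<Omega>"
    then have "openin (Cp_topology p \<Omega>) (Cp_nbhd p \<Omega> f {} 0 1)"
      by (intro openin_Cp_nbhd) (auto simp flip: zero_enat_def)
    from openin_subset[OF this] show "f \<in> topspace (Cp_topology p \<Omega>)"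
      using Cp_nbhd_self[OF f, of 1] by auto
  qed
qed

lemma norm_partials_Cp_nbhd:
  fixes f g :: "real^'d \<Rightarrow> 'k::real_normed_field"
  assumes "open \<Omega>" "f \<in> Cp_space p \<Omega>" "g \<in> Cp_nbhd p \<Omega> f K n \<epsilon>"
    "compact K" "K \<subseteq> \<Omega>" "enat n \<le> p" "length w \<le> n" "x \<in> K"
  shows "norm (partials w (\<lambda>x. g x - f x) x) < \<epsilon>"
proof -
  have "(\<lambda>x. g x - f x) \<in> Cp_space p \<Omega>"
    using assms(1-3) by (auto simp: Cp_nbhd_def intro: Cp_space_diff)
  from norm_partials_le_Cp_seminorm[OF this assms(4-8)] assms(3) show ?thesis
    by (auto simp: Cp_nbhd_def)
qed

lemma norm_Cp_nbhd:
  fixes f g :: "real^'d \<Rightarrow> 'k::real_normed_field"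
  assumes "open \<Omega>" "f \<in> Cp_space p \<Omega>" "g \<in> Cp_nbhd p \<Omega> f K n \<epsilon>"
    "compact K" "K \<subseteq> \<Omega>" "enat n \<le> p" "x \<in> K"
  shows "norm (g x - f x) < \<epsilon>"
  using norm_partials_Cp_nbhd[OF assms(1-6), of "[]"] assms(7) by simp

text \<open>Two functions that agree on an open set containing \<open>K\<close> have the same partial derivatives
  on \<open>K\<close>, so they are not separated by the seminorms on \<open>K\<close>.\<close>

lemma open_Cp_topology_agree:
  assumes "openin (Cp_topology p \<Omega>) U" "f \<in> U"
  obtains K where "compact K" "K \<subseteq> \<Omega>"
    "\<And>g V. g \<in> Cp_space p \<Omega> \<Longrightarrow> open V \<Longrightarrow> K \<subseteq> V \<Longrightarrow> (\<And>x. x \<in> V \<Longrightarrow> g x = f x) \<Longrightarrow> g \<in> U"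
proof -
  have "generate_topology_on {{g \<in> Cp_space p \<Omega>. Cp_seminorm K n (\<lambda>x. g x - f x) < \<epsilon>} | f K n \<epsilon>.
        f \<in> Cp_space p \<Omega> \<and> compact K \<and> K \<subseteq> \<Omega> \<and> enat n \<le> p \<and> \<epsilon> > 0} U"
    using assms(1) unfolding Cp_topology_def by (rule openin_topology_generated_by)
  then have "\<exists>K. compact K \<and> K \<subseteq> \<Omega> \<and> (\<forall>g V. g \<in> Cp_space p \<Omega> \<longrightarrow> open V \<longrightarrow> K \<subseteq> V \<longrightarrow>
      (\<forall>x\<in>V. g x = f x) \<longrightarrow> g \<in> U)"
    using assms(2)
  proof induction
    case Empty
    then show ?case by simp
  next
    case (Int a b)
    then obtain K L where
      "compact K \<and> K \<subseteq> \<Omega> \<and> (\<forall>g V. g \<in> Cp_space p \<Omega> \<longrightarrow> open V \<longrightarrow> K \<subseteq> V \<longrightarrow> (\<forall>x\<in>V. g x = f x) \<longrightarrow> g \<in> a)"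
      "compact L \<and> L \<subseteq> \<Omega> \<and> (\<forall>g V. g \<in> Cp_space p \<Omega> \<longrightarrow> open V \<longrightarrow> L \<subseteq> V \<longrightarrow> (\<forall>x\<in>V. g x = f x) \<longrightarrow> g \<in> b)"
      by auto
    then show ?case by (intro exI[of _ "K \<union> L"]) (auto simp: compact_Un)
  next
    case (UN \<K>)
    then obtain k where "k \<in> \<K>" "f \<in> k" by auto
    from UN.IH[OF this] show ?case using \<open>k \<in> \<K>\<close> by (meson UnionI)
  next
    case (Basis s)
    then obtain f0 K n \<epsilon> where s: "s = {g \<in> Cp_space p \<Omega>. Cp_seminorm K n (\<lambda>x. g x - f0 x) < \<epsilon>}"
      and K: "compact K" "K \<subseteq> \<Omega>" by auto
    have "g \<in> s" if "g \<in> Cp_space p \<Omega>" "open V" "K \<subseteq> V" "\<forall>x\<in>V. g x = f x" for g V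
    proof -
      \<comment> \<open>The centre \<open>f0\<close> need not be \<open>f\<close>; \<open>g\<close>
        and \<open>f\<close> lie at the same distance from it.\<close>
      have "Cp_seminorm K n (\<lambda>x. g x - f0 x) = Cp_seminorm K n (\<lambda>x. f x - f0 x)"
        by (rule Cp_seminorm_cong[OF that(2,3)]) (simp add: that(4))
      with that(1) Basis.prems show ?thesis by (simp add: s)
    qed
    with K show ?case by blast
  qed
  with that show ?thesis by metis
qed

lemma mixing_imp_transitive: "mixing_map X T \<Longrightarrow> transitive_map X T"
  unfolding mixing_map_def transitive_map_def eventually_sequentially
  by (meson max.cobounded1 max.cobounded2)

text \<open>A tail of the exponents contains all large multiples of \<open>m\<close>. This allows
  every consequence of mixing to be drawn for \<open>T ^^ m\<close> too.\<close>

lemma mixing_map_funpow: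
  assumes "mixing_map X T" "m \<ge> 1"
  shows "mixing_map X (T ^^ m)"
  unfolding mixing_map_def
proof (intro allI impI)
  fix U V assume "openin X U \<and> U \<noteq> {} \<and> openin X V \<and> V \<noteq> {}"
  then obtain N where N: "\<And>n. n \<ge> N \<Longrightarrow> (T ^^ n) ` U \<inter> V \<noteq> {}"
    using assms(1) unfolding mixing_map_def eventually_sequentially by metis
  show "\<forall>\<^sub>F n in sequentially. ((T ^^ m) ^^ n) ` U \<inter> V \<noteq> {}"
    unfolding eventually_sequentially
  proof (intro exI[of _ N] allI impI)
    fix n assume "N \<le> n"
    also have "n \<le> m * n" using \<open>m \<ge> 1\<close> by simp
    finally show "((T ^^ m) ^^ n) ` U \<inter> V \<noteq> {}"
      using N[of "m * n"] by (simp add: funpow_mult)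
  qed
qed

section \<open>Mixing weighted composition operators\<close>

locale weighted_composition =
  fixes p :: enat and \<Omega> :: "(real^'d) set" and \<psi> :: "real^'d \<Rightarrow> real^'d"
    and \<omega> :: "real^'d \<Rightarrow> 'k::real_normed_field"
  assumes open_\<Omega>: "open \<Omega>" and p_ge_1: "1 \<le> p" and maps: "x \<in> \<Omega> \<Longrightarrow> \<psi> x \<in> \<Omega>"
    and Ck_\<psi>: "enat n \<le> p \<Longrightarrow> Ck_on n \<Omega> \<psi>" and Ck_\<omega>: "enat n \<le> p \<Longrightarrow> Ck_on n \<Omega> \<omega>"
begin

abbreviation T where "T \<equiv> weighted_comp \<Omega> \<omega> \<psi>"
abbreviation X :: "(real^'d \<Rightarrow> 'k) set" where "X \<equiv> Cp_space p \<Omega>"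

lemma enat_1_le: "enat 1 \<le> p"
  using p_ge_1 by (simp add: one_enat_def)

lemma X_iff: "f \<in> X \<longleftrightarrow> (\<forall>n. enat n \<le> p \<longrightarrow> Ck_on n \<Omega> f) \<and> (\<forall>x. x \<notin> \<Omega> \<longrightarrow> f x = 0)"
  by (rule Cp_space_iff[OF open_\<Omega>])

lemma maps_funpow: "x \<in> \<Omega> \<Longrightarrow> (\<psi> ^^ n) x \<in> \<Omega>"
  by (induction n) (auto simp: maps)

lemma Ck_\<psi>_funpow: "enat n \<le> p \<Longrightarrow> Ck_on n \<Omega> (\<psi> ^^ k)"
proof (induction k)
  case 0
  then show ?case by (simp add: id_def open_\<Omega>)
next
  case (Suc k)
  then have "Ck_on n \<Omega> (\<lambda>x. \<psi> ((\<psi> ^^ k) x))"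
    by (intro Ck_on_compose[OF open_\<Omega> open_\<Omega> _ _ Ck_\<psi>]) (auto simp: maps_funpow)
  then show ?case by (simp add: o_def)
qed

lemma T_in_X:
  assumes "f \<in> X"
  shows "T f \<in> X"
  unfolding weighted_comp_def
proof (rule Cp_space_extend[OF open_\<Omega>])
  fix n assume n: "enat n \<le> p"
  then have "Ck_on n \<Omega> f" using assms by (simp add: X_iff)
  with n show "Ck_on n \<Omega> (\<lambda>x. \<omega> x * f (\<psi> x))"
    by (intro Ck_on_mult open_\<Omega> Ck_\<omega> Ck_on_compose[OF open_\<Omega> open_\<Omega> _ Ck_\<psi>]) (auto simp: maps)
qed

lemma T_funpow_in_X: "f \<in> X \<Longrightarrow> (T ^^ n) f \<in> X"
  by (induction n) (auto simp: T_in_X)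

lemma T_funpow_eq: "x \<in> \<Omega> \<Longrightarrow> (T ^^ n) f x = (\<Prod>j<n. \<omega> ((\<psi> ^^ j) x)) * f ((\<psi> ^^ n) x)"
proof (induction n arbitrary: x)
  case 0
  then show ?case by simp
next
  case (Suc n)
  have "(T ^^ Suc n) f x = \<omega> x * (T ^^ n) f (\<psi> x)"
    using Suc.prems by (simp add: weighted_comp_def)
  also have "\<dots> = \<omega> x * (\<Prod>j<n. \<omega> ((\<psi> ^^ Suc j) x)) * f ((\<psi> ^^ Suc n) x)"
    by (simp add: Suc.IH maps Suc.prems funpow_swap1)
  also have "\<dots> = (\<Prod>j<Suc n. \<omega> ((\<psi> ^^ j) x)) * f ((\<psi> ^^ Suc n) x)"
    by (subst prod.lessThan_Suc_shift) simp
  finally show ?case .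
qed

text \<open>The bound \<open>m \<ge> 1\<close> matters outside \<open>\<Omega>\<close>:
  \<open>T ^^ 0\<close> is the identity even on functions that do not vanish there.\<close>

lemma T_funpow_weighted_comp:
  "m \<ge> 1 \<Longrightarrow> T ^^ m = weighted_comp \<Omega> (\<lambda>x. \<Prod>j<m. \<omega> ((\<psi> ^^ j) x)) (\<psi> ^^ m)"
proof (intro ext)
  fix f x assume "m \<ge> 1"
  then have "x \<notin> \<Omega> \<Longrightarrow> (T ^^ m) f x = 0"
    by (cases m) (simp_all add: weighted_comp_def)
  then show "(T ^^ m) f x = weighted_comp \<Omega> (\<lambda>x. \<Prod>j<m. \<omega> ((\<psi> ^^ j) x)) (\<psi> ^^ m) f x"
    by (simp add: weighted_comp_def T_funpow_eq)
qed

lemma funpow_weighted_composition: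
  "weighted_composition p \<Omega> (\<psi> ^^ m) (\<lambda>x. \<Prod>j<m. \<omega> ((\<psi> ^^ j) x))"
proof unfold_locales
  show "Ck_on n \<Omega> (\<lambda>x. \<Prod>j<m. \<omega> ((\<psi> ^^ j) x))" if "enat n \<le> p" for n
    using that maps_funpow
    by (intro Ck_on_prod Ck_on_compose[OF open_\<Omega> open_\<Omega> _ Ck_\<psi>_funpow Ck_\<omega>] open_\<Omega>) auto
qed (simp_all add: open_\<Omega> p_ge_1 maps_funpow Ck_\<psi>_funpow)

end

section \<open>Necessary conditions for mixing\<close>

context weighted_composition
begin

text \<open>Density of the range of \<open>T\<close>, the only form in which mixing enters the
  pointwise conditions on \<open>\<omega>\<close> and \<open>\<psi>\<close> below, up to running
  away.\<close>

lemma approx_range: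
  assumes "mixing_map (Cp_topology p \<Omega>) T" "f \<in> X" "compact K" "K \<subseteq> \<Omega>" "enat n \<le> p" "\<epsilon> > 0"
  obtains h where "h \<in> X" "T h \<in> Cp_nbhd p \<Omega> f K n \<epsilon>"
proof -
  have "openin (Cp_topology p \<Omega>) X"
    using openin_topspace[of "Cp_topology p \<Omega>"] by simp
  moreover have "X \<noteq> {}" using assms(2) by auto
  moreover have "Cp_nbhd p \<Omega> f K n \<epsilon> \<noteq> {}"
    using Cp_nbhd_self assms(2,6) by blast
  ultimately have "\<forall>\<^sub>F m in sequentially. (T ^^ m) ` X \<inter> Cp_nbhd p \<Omega> f K n \<epsilon> \<noteq> {}"
    using assms(1) openin_Cp_nbhd[OF assms(2-6)] by (simp add: mixing_map_def)
  \<comment> \<open>A positive exponent exhibits the element as \<open>T\<close> of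
    something.\<close>
  then obtain m where "(T ^^ Suc m) ` X \<inter> Cp_nbhd p \<Omega> f K n \<epsilon> \<noteq> {}"
    unfolding eventually_sequentially by (meson le_SucI order_refl)
  then obtain g where "g \<in> X" "T ((T ^^ m) g) \<in> Cp_nbhd p \<Omega> f K n \<epsilon>" by auto
  with that T_funpow_in_X show ?thesis by blast
qed

text \<open>At a zero of \<open>\<omega>\<close> every \<open>T h\<close> vanishes, so none is
  within 1 of the constant 1 there.\<close>

lemma mixing_imp_\<omega>_nonzero:
  assumes "mixing_map (Cp_topology p \<Omega>) T" "x \<in> \<Omega>"
  shows "\<omega> x \<noteq> 0"
proof
  assume "\<omega> x = 0"
  have one: "(\<lambda>x. if x \<in> \<Omega> then 1 else 0) \<in> X"
    by (rule Cp_space_extend[OF open_\<Omega>]) simp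
  have K: "compact {x}" "{x} \<subseteq> \<Omega>" "enat 0 \<le> p" using assms(2) by (auto simp flip: zero_enat_def)
  obtain h where "T h \<in> Cp_nbhd p \<Omega> (\<lambda>x. if x \<in> \<Omega> then 1 else 0) {x} 0 1"
    using approx_range[OF assms(1) one K, of 1] by auto
  from norm_Cp_nbhd[OF open_\<Omega> one this K, of x] show False
    using \<open>\<omega> x = 0\<close> assms(2) by (simp add: weighted_comp_def)
qed

text \<open>If \<open>\<psi> a = \<psi> b\<close>, then \<open>f \<mapsto> \<omega> b * f a - \<omega> a * f b\<close> vanishes on the range of \<open>T\<close>, which is
  dense because \<open>T\<close> is mixing.\<close>

lemma mixing_imp_inj_on:
  assumes "mixing_map (Cp_topology p \<Omega>) T"
  shows "inj_on \<psi> \<Omega>"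
proof (rule inj_onI, rule ccontr)
  fix a b assume ab: "a \<in> \<Omega>" "b \<in> \<Omega>" "\<psi> a = \<psi> b" "a \<noteq> b"
  have nz: "\<omega> a \<noteq> 0" "\<omega> b \<noteq> 0" using mixing_imp_\<omega>_nonzero[OF assms] ab by auto
  \<comment> \<open>Normalised so that the affine function \<open>u\<close> is 1 at \<open>a\<close>
    and 0 at \<open>b\<close>.\<close>
  define v where "v = (1 / ((a - b) \<bullet> (a - b))) *\<^sub>R (a - b)"
  define u :: "real^'d \<Rightarrow> 'k" where "u y = of_real ((y - b) \<bullet> v)" for y
  have "u a = 1" "u b = 0" using ab by (auto simp: u_def v_def)
  have Ck_u: "Ck_on n \<Omega> u" for n
    unfolding u_def
    by (intro Ck_on_bounded_linear_compose[OF bounded_linear_of_real]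
        Ck_on_bounded_linear_compose[OF bounded_linear_inner_left] Ck_on_diff Ck_on_id Ck_on_const open_\<Omega>)
  have u: "(\<lambda>x. if x \<in> \<Omega> then u x else 0) \<in> X"
    by (rule Cp_space_extend[OF open_\<Omega> Ck_u])
  have K: "compact {a, b}" "{a, b} \<subseteq> \<Omega>" "enat 0 \<le> p" using ab by (auto simp flip: zero_enat_def)
  \<comment> \<open>Chosen so that the functional, applied to an error below
    \<open>\<epsilon>\<close>, stays strictly below its value \<open>\<omega> b\<close> at
    \<open>u\<close>.\<close>
  define \<epsilon> where "\<epsilon> = norm (\<omega> b) / (norm (\<omega> a) + norm (\<omega> b))"
  have den: "norm (\<omega> a) + norm (\<omega> b) > 0" using nz by (simp add: add_pos_pos)
  then have "\<epsilon> > 0" using nz by (simp add: \<epsilon>_def)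
  then obtain h where h: "T h \<in> Cp_nbhd p \<Omega> (\<lambda>x. if x \<in> \<Omega> then u x else 0) {a, b} 0 \<epsilon>"
    using approx_range[OF assms u K] by blast
  define c where "c = h (\<psi> a)"
  have "norm (\<omega> a * c - 1) < \<epsilon>" "norm (\<omega> b * c) < \<epsilon>"
    using norm_Cp_nbhd[OF open_\<Omega> u h K, of a] norm_Cp_nbhd[OF open_\<Omega> u h K, of b] ab \<open>u a = 1\<close> \<open>u b = 0\<close>
    by (auto simp: weighted_comp_def c_def)
  have "norm (\<omega> b) = norm (\<omega> a * (\<omega> b * c) - \<omega> b * (\<omega> a * c - 1))"
    by (simp add: algebra_simps)
  also have "\<dots> \<le> norm (\<omega> a) * norm (\<omega> b * c) + norm (\<omega> b) * norm (\<omega> a * c - 1)"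
    by (metis norm_triangle_ineq4 norm_mult)
  also have "\<dots> < norm (\<omega> a) * \<epsilon> + norm (\<omega> b) * \<epsilon>"
    using nz \<open>norm (\<omega> a * c - 1) < \<epsilon>\<close> \<open>norm (\<omega> b * c) < \<epsilon>\<close>
    by (intro add_strict_mono mult_strict_left_mono) auto
  also have "\<dots> = norm (\<omega> b)"
    using den unfolding distrib_right[symmetric] \<epsilon>_def by simp
  finally show False by simp
qed

lemma T_has_derivative:
  assumes "h \<in> X" "x \<in> \<Omega>"
  shows "(T h has_derivative (\<lambda>v. \<omega> x * frechet_derivative h (at (\<psi> x)) (frechet_derivative \<psi> (at x) v)
      + frechet_derivative \<omega> (at x) v * h (\<psi> x))) (at x)"
proof (rule has_derivative_transform_within_open[OF _ open_\<Omega> assms(2)])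
  have 1: "enat (Suc 0) \<le> p" using enat_1_le by simp
  have h1: "Ck_on (Suc 0) \<Omega> h" using assms(1) 1 unfolding X_iff by blast
  note D = Ck_on_SucD[OF open_\<Omega> _ assms(2)]
  show "((\<lambda>x. \<omega> x * h (\<psi> x)) has_derivative (\<lambda>v. \<omega> x * frechet_derivative h (at (\<psi> x)) (frechet_derivative \<psi> (at x) v)
      + frechet_derivative \<omega> (at x) v * h (\<psi> x))) (at x)"
    by (rule has_derivative_mult[OF D[OF Ck_\<omega>[OF 1]]
        has_derivative_compose[OF D[OF Ck_\<psi>[OF 1]] Ck_on_SucD[OF open_\<Omega> h1 maps[OF assms(2)]]]])
qed (simp add: weighted_comp_def)

text \<open>If \<open>v\<close> is in the kernel of the derivative of \<open>\<psi>\<close> at \<open>x\<close>, then the derivative of \<open>T h\<close> at \<open>x\<close>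
  along \<open>v\<close> is a multiple of \<open>h (\<psi> x)\<close>, hence of \<open>T h x\<close>, with a factor independent of \<open>h\<close>.\<close>

lemma mixing_imp_derivative_inj:
  assumes "mixing_map (Cp_topology p \<Omega>) T" "x \<in> \<Omega>" "frechet_derivative \<psi> (at x) v = 0"
  shows "v = 0"
proof (rule ccontr)
  assume "v \<noteq> 0"
  have nz: "\<omega> x \<noteq> 0" using mixing_imp_\<omega>_nonzero[OF assms(1,2)] .
  \<comment> \<open>\<open>u\<close> vanishes at \<open>x\<close> but has derivative
    \<open>v \<bullet> v\<close> along \<open>v\<close>, which no multiple of its value at
    \<open>x\<close> can match.\<close>
  define u :: "real^'d \<Rightarrow> 'k" where "u y = of_real ((y - x) \<bullet> v)" for y
  let ?u = "\<lambda>y. if y \<in> \<Omega> then u y else 0"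
  have "Ck_on n \<Omega> u" for n
    unfolding u_def
    by (intro Ck_on_bounded_linear_compose[OF bounded_linear_of_real]
        Ck_on_bounded_linear_compose[OF bounded_linear_inner_left] Ck_on_diff Ck_on_id Ck_on_const open_\<Omega>)
  then have u: "?u \<in> X"
    by (rule Cp_space_extend[OF open_\<Omega>])
  have "(u has_derivative (\<lambda>w. of_real (w \<bullet> v))) (at x)"
    unfolding u_def
    by (intro bounded_linear.has_derivative[OF bounded_linear_of_real]
        bounded_linear.has_derivative[OF bounded_linear_inner_left]) (auto intro!: derivative_eq_intros)
  then have der_u: "(?u has_derivative (\<lambda>w. of_real (w \<bullet> v))) (at x)"
    by (rule has_derivative_transform_within_open[OF _ open_\<Omega> assms(2)]) simp
  define a where "a = frechet_derivative \<omega> (at x) v"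
  \<comment> \<open>The first term of the denominator accounts for the error in the value at
    \<open>x\<close>, which bounds \<open>c\<close>. The second accounts for the error in the
    derivative along \<open>v\<close>: the seminorm controls only the axes, so \<open>v\<close> is
    expanded over them. The 1 makes the final inequality strict.\<close>
  define \<epsilon> where "\<epsilon> = (v \<bullet> v) / (norm a / norm (\<omega> x) + (\<Sum>i\<in>UNIV. \<bar>v $ i\<bar>) + 1)"
  have den: "norm a / norm (\<omega> x) + (\<Sum>i\<in>UNIV. \<bar>v $ i\<bar>) + 1 > 0"
    by (intro add_nonneg_pos add_nonneg_nonneg sum_nonneg) auto
  then have "\<epsilon> > 0" using \<open>v \<noteq> 0\<close> by (simp add: \<epsilon>_def)
  have K: "compact {x}" "{x} \<subseteq> \<Omega>" using assms(2) by auto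
  obtain h where "h \<in> X" and h: "T h \<in> Cp_nbhd p \<Omega> ?u {x} 1 \<epsilon>"
    using approx_range[OF assms(1) u K enat_1_le \<open>\<epsilon> > 0\<close>] by blast
  define c where "c = h (\<psi> x)"
  obtain H where "(T h has_derivative H) (at x)" and Hv: "H v = a * c"
  proof
    show "(T h has_derivative (\<lambda>v. \<omega> x * frechet_derivative h (at (\<psi> x)) (frechet_derivative \<psi> (at x) v)
      + frechet_derivative \<omega> (at x) v * h (\<psi> x))) (at x)"
      by (rule T_has_derivative[OF \<open>h \<in> X\<close> assms(2)])
    have "linear (frechet_derivative h (at (\<psi> x)))"
      using has_derivative_linear Ck_on_SucD[OF open_\<Omega>, of 0 h] \<open>h \<in> X\<close> enat_1_le maps[OF assms(2)]
      unfolding X_iff by (metis One_nat_def)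
    then show "\<omega> x * frechet_derivative h (at (\<psi> x)) (frechet_derivative \<psi> (at x) v)
      + frechet_derivative \<omega> (at x) v * h (\<psi> x) = a * c"
      by (simp add: assms(3) a_def c_def linear_0)
  qed
  then have der: "((\<lambda>y. T h y - ?u y) has_derivative (\<lambda>w. H w - of_real (w \<bullet> v))) (at x)"
    by (intro has_derivative_diff der_u)
  define E where "E w = H w - of_real (w \<bullet> v)" for w
  have "linear E" using has_derivative_linear[OF der] by (simp add: E_def[abs_def])
  have E_axis: "norm (E (axis i 1)) < \<epsilon>" for i
    using norm_partials_Cp_nbhd[OF open_\<Omega> u h K enat_1_le, of "[i]" x] partial_eq_derivative[OF der, of i]
    by (simp add: E_def)
  have "E v = E (\<Sum>i\<in>UNIV. v $ i *\<^sub>R axis i 1)"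
    using basis_expansion[of v] by (simp add: scalar_mult_eq_scaleR)
  also have "\<dots> = (\<Sum>i\<in>UNIV. v $ i *\<^sub>R E (axis i 1))"
    by (simp add: linear_sum[OF \<open>linear E\<close>] linear_scale[OF \<open>linear E\<close>])
  also have "norm \<dots> \<le> (\<Sum>i\<in>UNIV. \<bar>v $ i\<bar> * \<epsilon>)"
    by (rule sum_norm_le) (use E_axis in \<open>simp add: mult_left_mono less_imp_le\<close>)
  finally have E_v: "norm (E v) \<le> (\<Sum>i\<in>UNIV. \<bar>v $ i\<bar>) * \<epsilon>"
    by (simp add: sum_distrib_right)
  have "norm (\<omega> x * c) < \<epsilon>"
    using norm_Cp_nbhd[OF open_\<Omega> u h K enat_1_le, of x] assms(2)
    by (simp add: weighted_comp_def c_def u_def)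
  then have c: "norm c \<le> \<epsilon> / norm (\<omega> x)"
    using nz by (simp add: norm_mult field_simps)
  have "v \<bullet> v = norm (of_real (v \<bullet> v) :: 'k)" by simp
  also have "\<dots> = norm (a * c - E v)" by (simp add: E_def Hv)
  also have "\<dots> \<le> norm a * norm c + norm (E v)"
    by (metis norm_triangle_ineq4 norm_mult)
  also have "\<dots> \<le> norm a * (\<epsilon> / norm (\<omega> x)) + (\<Sum>i\<in>UNIV. \<bar>v $ i\<bar>) * \<epsilon>"
    by (intro add_mono mult_left_mono c E_v) auto
  also have "\<dots> = (norm a / norm (\<omega> x) + (\<Sum>i\<in>UNIV. \<bar>v $ i\<bar>)) * \<epsilon>"
    by (simp add: algebra_simps)
  also have "\<dots> < (norm a / norm (\<omega> x) + (\<Sum>i\<in>UNIV. \<bar>v $ i\<bar>) + 1) * \<epsilon>"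
    using \<open>\<epsilon> > 0\<close> by (intro mult_strict_right_mono) auto
  also have "\<dots> = v \<bullet> v"
    using den by (simp add: \<epsilon>_def)
  finally show False by simp
qed

text \<open>If \<open>x\<close> and \<open>\<psi>\<^sup>n x\<close> lie in \<open>K\<close>, moving functions small on \<open>K\<close> near \<open>1\<close> makes the weight
  \<open>\<Prod>j<n. \<omega> (\<psi>\<^sup>j x)\<close> larger than \<open>1\<close>, and moving functions near \<open>1\<close> to small ones makes it smaller
  than \<open>1\<close>. A mixing \<open>T\<close> does both for the same \<open>n\<close>.\<close>

lemma mixing_imp_run_away:
  assumes "mixing_map (Cp_topology p \<Omega>) T" "compact K" "K \<subseteq> \<Omega>"
  shows "\<forall>\<^sub>F n in sequentially. (\<psi> ^^ n) ` K \<inter> K = {}"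
proof -
  \<comment> \<open>The radius 1/2 separates the two sets on \<open>K\<close>: elements of
    \<open>U\<close> have norm above 1/2 there, elements of \<open>V\<close> below.\<close>
  define U where "U = Cp_nbhd p \<Omega> (\<lambda>x. if x \<in> \<Omega> then 1 else 0 :: 'k) K 0 (1/2)"
  define V where "V = Cp_nbhd p \<Omega> (\<lambda>x. 0 :: 'k) K 0 (1/2)"
  have p0: "enat 0 \<le> p" by (simp flip: zero_enat_def)
  have one: "(\<lambda>x. if x \<in> \<Omega> then 1 else 0) \<in> X"
    by (rule Cp_space_extend[OF open_\<Omega>]) simp
  note zero = zero_in_Cp_space[OF open_\<Omega>, where p = p and ?'k = 'k]
  have U: "norm (g x - 1) < 1/2" if "g \<in> U" "x \<in> K" for g x
    using norm_Cp_nbhd[OF open_\<Omega> one that(1)[unfolded U_def] assms(2,3) p0 that(2)] that(2) assms(3)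
    by (auto split: if_splits)
  have V: "norm (g x) < 1/2" if "g \<in> V" "x \<in> K" for g x
    using norm_Cp_nbhd[OF open_\<Omega> zero that(1)[unfolded V_def] assms(2,3) p0 that(2)] by simp
  have "openin (Cp_topology p \<Omega>) U" "openin (Cp_topology p \<Omega>) V"
    unfolding U_def V_def by (intro openin_Cp_nbhd one zero assms p0; simp)+
  moreover have "U \<noteq> {}" "V \<noteq> {}"
    using Cp_nbhd_self[OF one, of "1/2" K 0] Cp_nbhd_self[OF zero, of "1/2" K 0]
    by (auto simp: U_def V_def)
  ultimately have "\<forall>\<^sub>F n in sequentially. (T ^^ n) ` U \<inter> V \<noteq> {}"
    "\<forall>\<^sub>F n in sequentially. (T ^^ n) ` V \<inter> U \<noteq> {}"
    using assms(1) by (auto simp: mixing_map_def)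
  then show ?thesis
  proof eventually_elim
    case (elim n)
    then obtain f g where f: "f \<in> U" "(T ^^ n) f \<in> V" and g: "g \<in> V" "(T ^^ n) g \<in> U" by blast
    have False if x: "x \<in> K" and y: "(\<psi> ^^ n) x \<in> K" for x
    proof -
      define W where "W = (\<Prod>j<n. \<omega> ((\<psi> ^^ j) x))"
      define y where "y = (\<psi> ^^ n) x"
      have T: "(T ^^ n) h x = W * h y" for h
        using x assms(3) by (auto simp: T_funpow_eq W_def y_def)
      have "y \<in> K" using \<open>(\<psi> ^^ n) x \<in> K\<close> by (simp add: y_def)
      have big: "norm z > 1/2" if "norm (z - 1) < 1/2" for z :: 'k
        using norm_triangle_ineq2[of 1 "1 - z"] that by (simp add: norm_minus_commute)
      have "norm W * norm (f y) < 1/2" "norm (f y) > 1/2"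
        using V[OF f(2) x] big[OF U[OF f(1) \<open>y \<in> K\<close>]] by (simp_all add: T norm_mult)
      then have "norm W < 1"
        using mult_right_mono[of 1 "norm W" "norm (f y)"] by linarith
      moreover have "norm W * norm (g y) > 1/2" "norm (g y) < 1/2"
        using big[OF U[OF g(2) x]] V[OF g(1) \<open>y \<in> K\<close>] by (simp_all add: T norm_mult)
      ultimately show False
        using mult_right_mono[of "norm W" 1 "norm (g y)"] by simp
    qed
    then show ?case by auto
  qed
qed

end

section \<open>Fixed points\<close>

text \<open>Collects what the fixed point construction takes from mixing, in terms of
  \<open>\<psi>\<close> and \<open>\<omega>\<close> alone.\<close>

locale run_away_composition = weighted_composition p \<Omega> \<psi> \<omega>
  for p \<Omega> and \<psi> :: "real^'d \<Rightarrow> real^'d" and \<omega> :: "real^'d \<Rightarrow> 'k::real_normed_field" +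
  assumes nonzero: "x \<in> \<Omega> \<Longrightarrow> \<omega> x \<noteq> 0" and inj: "inj_on \<psi> \<Omega>"
    and derivative_inj: "x \<in> \<Omega> \<Longrightarrow> frechet_derivative \<psi> (at x) v = 0 \<Longrightarrow> v = 0"
    and run_away: "compact K \<Longrightarrow> K \<subseteq> \<Omega> \<Longrightarrow> \<forall>\<^sub>F n in sequentially. (\<psi> ^^ n) ` K \<inter> K = {}"
begin

abbreviation \<phi> where "\<phi> \<equiv> inv_into \<Omega> \<psi>"

text \<open>A right inverse of \<open>T\<close>. The extension by \<open>0\<close> outside \<open>\<psi> ` \<Omega>\<close> is of class $C^p$ on \<open>\<Omega>\<close> only if
  \<open>h\<close> has compact support in \<open>\<Omega>\<close>.\<close>

definition R :: "(real^'d \<Rightarrow> 'k) \<Rightarrow> real^'d \<Rightarrow> 'k" where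
  "R h x = (if x \<in> \<psi> ` \<Omega> then h (\<phi> x) / \<omega> (\<phi> x) else 0)"

lemma T_R: "h \<in> X \<Longrightarrow> T (R h) = h"
  by (auto simp: weighted_comp_def R_def X_iff inv_into_f_f[OF inj] nonzero)

lemma continuous_on_\<psi>: "continuous_on \<Omega> \<psi>"
  by (rule Ck_on_imp_continuous_on[OF open_\<Omega> Ck_\<psi>[OF enat_1_le]])

lemma open_image: "open (\<psi> ` \<Omega>)"
  by (rule invariance_of_domain[OF continuous_on_\<psi> open_\<Omega> inj])

lemma Ck_\<phi>:
  assumes "enat n \<le> p"
  shows "Ck_on n (\<psi> ` \<Omega>) \<phi>"
proof (rule Ck_on_le[OF open_image])
  \<comment> \<open>The result on inverses needs order at least 1; order 0 is then obtained by
    weakening.\<close>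
  have "enat (max 1 n) \<le> p" using assms enat_1_le by (simp add: max_def)
  then show "Ck_on (max 1 n) (\<psi> ` \<Omega>) \<phi>"
    by (rule Ck_on_inv_into[OF open_\<Omega> inj Ck_\<psi> _ derivative_inj]) simp_all
qed simp

text \<open>Two open sets cover \<open>\<Omega>\<close>: the image of \<open>\<Omega>\<close>, where
  the quotient formula is regular, and the complement of the compact image of \<open>L\<close>,
  where \<open>R h\<close> is zero.\<close>

lemma R_in_X:
  assumes "h \<in> X" "compact L" "L \<subseteq> \<Omega>" "\<And>x. x \<notin> L \<Longrightarrow> h x = 0"
  shows "R h \<in> X" and "x \<notin> \<psi> ` L \<Longrightarrow> R h x = 0"
proof -
  show zero: "R h x = 0" if "x \<notin> \<psi> ` L" for x
  proof -
    have "\<phi> x \<notin> L" if "x \<in> \<psi> ` \<Omega>"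
      using \<open>x \<notin> \<psi> ` L\<close> f_inv_into_f[OF that] by (metis imageI)
    then show ?thesis using assms(4) by (simp add: R_def)
  qed
  have closed: "closed (\<psi> ` L)"
    by (intro compact_imp_closed compact_continuous_image continuous_on_subset[OF continuous_on_\<psi>] assms)
  have "Ck_on n \<Omega> (R h)" if n: "enat n \<le> p" for n
  proof (rule Ck_on_local)
    fix x assume "x \<in> \<Omega>"
    show "\<exists>U. open U \<and> x \<in> U \<and> Ck_on n U (R h)"
    proof (cases "x \<in> \<psi> ` \<Omega>")
      case True
      have h: "Ck_on n \<Omega> h" using assms(1) n by (simp add: X_iff)
      have im: "\<phi> ` \<psi> ` \<Omega> \<subseteq> \<Omega>" by (auto simp: inv_into_f_f[OF inj])
      have "Ck_on n (\<psi> ` \<Omega>) (\<lambda>x. h (\<phi> x) / \<omega> (\<phi> x))"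
        using nonzero im
        by (intro Ck_on_divide open_image Ck_on_compose[OF open_image open_\<Omega> im Ck_\<phi>[OF n]] h Ck_\<omega>[OF n]) auto
      then have "Ck_on n (\<psi> ` \<Omega>) (R h)"
        by (rule Ck_on_cong_imp[OF open_image]) (simp add: R_def)
      with True open_image show ?thesis by blast
    next
      case False
      have "Ck_on n (- \<psi> ` L) (R h)"
        by (rule Ck_on_cong_imp[OF _ Ck_on_const[of _ _ 0]]) (use closed zero in auto)
      then show ?thesis using False closed assms(3) by (intro exI[of _ "- \<psi> ` L"]) auto
    qed
  qed
  moreover have "R h x = 0" if "x \<notin> \<Omega>" for x
    using that zero[of x] assms(3) maps by blast
  ultimately show "R h \<in> X" by (simp add: X_iff)
qed

text \<open>\<open>R\<close> pushes supports forward by \<open>\<psi>\<close>, so they stay compact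
  in \<open>\<Omega>\<close> and \<open>R\<close> can be iterated without losing regularity.\<close>

lemma R_funpow_in_X:
  assumes "f \<in> X" "compact L" "L \<subseteq> \<Omega>" "\<And>x. x \<notin> L \<Longrightarrow> f x = 0"
  shows "(R ^^ k) f \<in> X" "x \<notin> (\<psi> ^^ k) ` L \<Longrightarrow> (R ^^ k) f x = 0"
proof -
  have "(R ^^ k) f \<in> X \<and> (\<forall>x. x \<notin> (\<psi> ^^ k) ` L \<longrightarrow> (R ^^ k) f x = 0)"
  proof (induction k)
    case 0
    then show ?case using assms by simp
  next
    case (Suc k)
    have "continuous_on L (\<psi> ^^ k)"
      using Ck_on_imp_continuous_on[OF open_\<Omega> Ck_\<psi>_funpow[OF enat_1_le]] assms(3)
      by (rule continuous_on_subset)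
    then have "compact ((\<psi> ^^ k) ` L)" using assms(2) by (rule compact_continuous_image)
    moreover have "(\<psi> ^^ k) ` L \<subseteq> \<Omega>" using maps_funpow assms(3) by blast
    ultimately show ?case
      using R_in_X[of "(R ^^ k) f" "(\<psi> ^^ k) ` L"] Suc by (simp add: image_image)
  qed
  then show "(R ^^ k) f \<in> X" "x \<notin> (\<psi> ^^ k) ` L \<Longrightarrow> (R ^^ k) f x = 0" by auto
qed

text \<open>The fixed point is the bilateral orbit sum \<open>\<Sum>k. T\<^sup>k f + R\<^sup>k\<^sup>+\<^sup>1 f\<close>, which is locally finite since
  \<open>\<psi>\<close> runs away from compact sets.\<close>

lemma fixed_point_extension:
  assumes f: "f \<in> X" "compact L" "L \<subseteq> \<Omega>" "\<And>x. x \<notin> L \<Longrightarrow> f x = 0"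
    and disj: "\<And>k. k \<ge> 1 \<Longrightarrow> (\<psi> ^^ k) ` L \<inter> L = {}"
  obtains g where "g \<in> X" "T g = g" "\<And>x. x \<in> L \<Longrightarrow> g x = f x"
proof -
  \<comment> \<open>The exponent \<open>Suc k\<close> ensures that \<open>f\<close> itself, the term
    of index zero, is counted once.\<close>
  define g where "g x = (\<Sum>k. (T ^^ k) f x + (R ^^ Suc k) f x)" for x
  note R = R_funpow_in_X[OF f]
  have T_zero: "(T ^^ k) f x = 0" if "(\<psi> ^^ k) x \<notin> L" "x \<in> \<Omega>" for k x
    using T_funpow_eq[OF that(2)] f(4)[OF that(1)] by simp
  have locally_finite: "\<exists>N. \<forall>k\<ge>N. \<forall>x\<in>B. (T ^^ k) f x = 0 \<and> (R ^^ k) f x = 0"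
    if B: "compact B" "B \<subseteq> \<Omega>" for B
  proof -
    \<comment> \<open>Running away for the union gives both facts at once: iterates of
      \<open>B\<close> miss \<open>L\<close>, which kills \<open>(T ^^ k) f\<close> on
      \<open>B\<close>, and iterates of \<open>L\<close> miss \<open>B\<close>, which kills
      \<open>(R ^^ k) f\<close> there.\<close>
    have "compact (B \<union> L)" "B \<union> L \<subseteq> \<Omega>" using f(2,3) B by (auto intro: compact_Un)
    from run_away[OF this] obtain N where N: "\<And>k. k \<ge> N \<Longrightarrow> (\<psi> ^^ k) ` (B \<union> L) \<inter> (B \<union> L) = {}"
      unfolding eventually_sequentially by auto
    show ?thesis
    proof (intro exI[of _ N] allI impI ballI conjI)
      fix k x assume "N \<le> k" "x \<in> B"
      then show "(T ^^ k) f x = 0" "(R ^^ k) f x = 0"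
        using N[OF \<open>N \<le> k\<close>] B(2) by (blast intro: T_zero R(2))+
    qed
  qed
  have g_eq: "g x = (\<Sum>k<N. (T ^^ k) f x + (R ^^ Suc k) f x)"
    if "\<And>k. k \<ge> N \<Longrightarrow> (T ^^ k) f x = 0 \<and> (R ^^ k) f x = 0" for x N
    unfolding g_def by (rule suminf_finite) (use that in \<open>auto simp del: funpow.simps\<close>)
  have outside: "g x = 0" if "x \<notin> \<Omega>" for x
    using that T_funpow_in_X[OF f(1)] R(1) unfolding g_def X_iff by (simp del: funpow.simps)
  have "Ck_on n \<Omega> g" if n: "enat n \<le> p" for n
  proof (rule Ck_on_local)
    fix x assume "x \<in> \<Omega>"
    then obtain r where r: "r > 0" "cball x r \<subseteq> \<Omega>" using open_\<Omega> by (meson open_contains_cball)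
    from locally_finite[OF compact_cball r(2)] obtain N where
      N: "\<And>k y. k \<ge> N \<Longrightarrow> y \<in> cball x r \<Longrightarrow> (T ^^ k) f y = 0 \<and> (R ^^ k) f y = 0" by blast
    have "Ck_on n \<Omega> (\<lambda>y. \<Sum>k<N. (T ^^ k) f y + (R ^^ Suc k) f y)"
      using T_funpow_in_X[OF f(1)] R(1) n unfolding X_iff
      by (intro Ck_on_sum Ck_on_add open_\<Omega>) blast+
    then have "Ck_on n (ball x r) (\<lambda>y. \<Sum>k<N. (T ^^ k) f y + (R ^^ Suc k) f y)"
      by (rule Ck_on_subset) (use r in auto)
    then have "Ck_on n (ball x r) g"
    proof (rule Ck_on_cong_imp[OF open_ball])
      fix y assume "y \<in> ball x r"
      then have "y \<in> cball x r" by simp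
      then show "(\<Sum>k<N. (T ^^ k) f y + (R ^^ Suc k) f y) = g y"
        by (intro g_eq[symmetric] N)
    qed
    then show "\<exists>U. open U \<and> x \<in> U \<and> Ck_on n U g" using r(1) by (intro exI[of _ "ball x r"]) auto
  qed
  with outside have "g \<in> X" by (simp add: X_iff)
  moreover have "T g = g"
  proof
    fix x
    show "T g x = g x"
    proof (cases "x \<in> \<Omega>")
      case True
      \<comment> \<open>One \<open>N\<close> must truncate the sums for both \<open>g x\<close> and
        \<open>g (\<psi> x)\<close>, since \<open>T g x\<close> involves the latter.\<close>
      have "{x, \<psi> x} \<subseteq> \<Omega>" using True maps by auto
      from locally_finite[OF _ this] obtain N where
        N: "\<And>k y. k \<ge> N \<Longrightarrow> y \<in> {x, \<psi> x} \<Longrightarrow> (T ^^ k) f y = 0 \<and> (R ^^ k) f y = 0" by auto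
      have T: "T h x = \<omega> x * h (\<psi> x)" for h
        using True by (simp add: weighted_comp_def)
      have "T g x = (\<Sum>k<N. T ((T ^^ k) f) x + T ((R ^^ Suc k) f) x)"
        unfolding T using g_eq[of N "\<psi> x"] N by (simp add: sum_distrib_left distrib_left)
      also have "\<dots> = (\<Sum>k<N. (T ^^ Suc k) f x + (R ^^ k) f x)"
        using T_R[OF R(1)] by simp
      \<comment> \<open>\<open>T\<close> shifts the bilateral orbit by one place, so the difference
        telescopes: the end at \<open>N\<close> vanishes, and at \<open>0\<close> both orbits equal
        \<open>f\<close> and cancel.\<close>
      finally have "T g x - g x = (\<Sum>k<N. ((T ^^ Suc k) f x - (R ^^ Suc k) f x) - ((T ^^ k) f x - (R ^^ k) f x))"
        using g_eq[of N x] N by (simp add: sum_subtractf sum.distrib)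
      also have "\<dots> = 0"
        using sum_lessThan_telescope[of "\<lambda>k. (T ^^ k) f x - (R ^^ k) f x" N] N[of N x] by simp
      finally show ?thesis by simp
    qed (simp add: outside weighted_comp_def)
  qed
  moreover have "g x = f x" if "x \<in> L" for x
  proof -
    have zero: "(T ^^ k) f x = 0 \<and> (R ^^ k) f x = 0" if "k \<ge> 1" for k
      using disj[OF that] \<open>x \<in> L\<close> f(3) by (blast intro: T_zero R(2))
    \<comment> \<open>Truncation at \<open>N = 1\<close> leaves \<open>f x + R f x\<close>, and the
      second summand is zero on \<open>L\<close>.\<close>
    show ?thesis using g_eq[OF zero] zero[of 1] by simp
  qed
  ultimately show ?thesis by (rule that)
qed

end

section \<open>Density of the periodic points\<close>

context weighted_composition
begin

lemma mixing_imp_run_away_composition: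
  assumes "mixing_map (Cp_topology p \<Omega>) T"
  shows "run_away_composition p \<Omega> \<psi> \<omega>"
proof unfold_locales
  show "inj_on \<psi> \<Omega>" by (rule mixing_imp_inj_on[OF assms])
  show "\<omega> x \<noteq> 0" if "x \<in> \<Omega>" for x
    by (rule mixing_imp_\<omega>_nonzero[OF assms that])
  show "v = 0" if "x \<in> \<Omega>" "frechet_derivative \<psi> (at x) v = 0" for x v
    by (rule mixing_imp_derivative_inj[OF assms that])
  show "\<forall>\<^sub>F n in sequentially. (\<psi> ^^ n) ` K \<inter> K = {}" if "compact K" "K \<subseteq> \<Omega>" for K
    by (rule mixing_imp_run_away[OF assms that])
qed

lemma mixing_imp_dense_periodic:
  assumes "mixing_map (Cp_topology p \<Omega>) T"
  shows "Cp_topology p \<Omega> closure_of periodic_points (Cp_topology p \<Omega>) T = X"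
proof
  show "Cp_topology p \<Omega> closure_of periodic_points (Cp_topology p \<Omega>) T \<subseteq> X"
    using closure_of_subset_topspace[of "Cp_topology p \<Omega>"] by simp
  show "X \<subseteq> Cp_topology p \<Omega> closure_of periodic_points (Cp_topology p \<Omega>) T"
  proof
    fix f assume f: "f \<in> X"
    have "\<exists>g. g \<in> periodic_points (Cp_topology p \<Omega>) T \<and> g \<in> U"
      if U: "f \<in> U" "openin (Cp_topology p \<Omega>) U" for U
    proof -
      obtain K where K: "compact K" "K \<subseteq> \<Omega>" and
        agree: "\<And>g V. g \<in> X \<Longrightarrow> open V \<Longrightarrow> K \<subseteq> V \<Longrightarrow> (\<And>x. x \<in> V \<Longrightarrow> g x = f x) \<Longrightarrow> g \<in> U"
        using open_Cp_topology_agree[OF U(2,1)] by blast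
      obtain \<kappa> :: "real^'d \<Rightarrow> real" and L V where L: "compact L" "L \<subseteq> \<Omega>" and V: "open V" "K \<subseteq> V"
        and \<kappa>: "\<And>x. x \<in> V \<Longrightarrow> \<kappa> x = 1" "\<And>x. x \<notin> L \<Longrightarrow> \<kappa> x = 0" "\<And>n. Ck_on n UNIV \<kappa>"
        using smooth_cutoff[OF K(1) open_\<Omega> K(2)] by metis
      obtain N where N: "\<And>n. n \<ge> N \<Longrightarrow> (\<psi> ^^ n) ` L \<inter> L = {}"
        using mixing_imp_run_away[OF assms L] unfolding eventually_sequentially by blast
      \<comment> \<open>\<open>m\<close> serves as a period, hence \<open>m \<ge> 1\<close>; being
        at least \<open>N\<close>, it puts all its positive multiples beyond
        \<open>N\<close>.\<close>
      define m where "m = max 1 N"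
      have m: "m \<ge> 1" by (simp add: m_def)
      interpret S: weighted_composition p \<Omega> "\<psi> ^^ m" "\<lambda>x. \<Prod>j<m. \<omega> ((\<psi> ^^ j) x)"
        by (rule funpow_weighted_composition)
      have S_eq: "S.T = T ^^ m" by (rule T_funpow_weighted_comp[OF m, symmetric])
      \<comment> \<open>The properties of \<open>\<psi> ^^ m\<close> and of the product weight are
        read off from the mixing of \<open>T ^^ m\<close>, instead of being derived from those of
        \<open>\<psi>\<close> and \<open>\<omega>\<close>.\<close>
      interpret S: run_away_composition p \<Omega> "\<psi> ^^ m" "\<lambda>x. \<Prod>j<m. \<omega> ((\<psi> ^^ j) x)"
        by (rule S.mixing_imp_run_away_composition) (simp only: S_eq mixing_map_funpow[OF assms m])
      have f': "(\<lambda>x. \<kappa> x *\<^sub>R f x) \<in> X"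
        unfolding X_iff
      proof (intro conjI allI impI)
        fix n assume "enat n \<le> p"
        with f show "Ck_on n \<Omega> (\<lambda>x. \<kappa> x *\<^sub>R f x)"
          by (intro Ck_on_scaleR open_\<Omega> Ck_on_subset[OF \<kappa>(3)]) (auto simp: X_iff)
      qed (use f in \<open>simp add: X_iff\<close>)
      have disj: "((\<psi> ^^ m) ^^ k) ` L \<inter> L = {}" if "k \<ge> 1" for k
      proof -
        have "N \<le> m" by (simp add: m_def)
        also have "m \<le> m * k" using that by simp
        finally have "m * k \<ge> N" .
        from N[OF this] show ?thesis by (simp add: funpow_mult)
      qed
      obtain g where g: "g \<in> X" "S.T g = g" "\<And>x. x \<in> L \<Longrightarrow> g x = \<kappa> x *\<^sub>R f x"
        using S.fixed_point_extension[OF f' L _ disj] \<kappa>(2) by auto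
      have "g x = f x" if "x \<in> V" for x
      proof -
        \<comment> \<open>Off \<open>L\<close> the cutoff is 0, whereas on \<open>V\<close> it is
          1.\<close>
        have "x \<in> L" using \<kappa>(1)[OF that] \<kappa>(2)[of x] by auto
        then show ?thesis using g(3) \<kappa>(1)[OF that] by simp
      qed
      then have "g \<in> U" by (rule agree[OF g(1) V])
      moreover have "g \<in> periodic_points (Cp_topology p \<Omega>) T"
        using g(1,2) m by (auto simp: periodic_points_def S_eq)
      ultimately show ?thesis by blast
    qed
    then show "f \<in> Cp_topology p \<Omega> closure_of periodic_points (Cp_topology p \<Omega>) T"
      using f by (auto simp: in_closure_of)
  qed
qed

lemma mixing_imp_chaotic:
  "mixing_map (Cp_topology p \<Omega>) T \<Longrightarrow> chaotic_map (Cp_topology p \<Omega>) T"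
  by (simp add: chaotic_map_def mixing_imp_transitive mixing_imp_dense_periodic)

end

lemma weighted_compositionI:
  assumes "open \<Omega>" "1 \<le> p" "Cp_self_map p \<Omega> \<psi>" "Cp_on p \<Omega> \<omega>"
  shows "weighted_composition p \<Omega> \<psi> \<omega>"
proof
  show "Ck_on n \<Omega> \<psi>" if "enat n \<le> p" for n
    using assms(1,3) that by (auto simp: Cp_self_map_def Cp_on_iff_Ck_on intro: Ck_on_vec)
  show "Ck_on n \<Omega> \<omega>" if "enat n \<le> p" for n
    using assms(1,4) that by (simp add: Cp_on_iff_Ck_on)
  show "\<psi> x \<in> \<Omega>" if "x \<in> \<Omega>" for x
    using assms(3) that by (auto simp: Cp_self_map_def)
qed fact+

theorem theorem3p1:
  fixes \<Omega> :: "(real^'d) set" and p :: enat and \<psi> :: "real^'d \<Rightarrow> real^'d"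
  assumes "open \<Omega>" and "1 \<le> p" and "Cp_self_map p \<Omega> \<psi>"
  shows "(\<forall>\<omega> :: real^'d \<Rightarrow> real. Cp_on p \<Omega> \<omega> \<longrightarrow>
            mixing_map (Cp_topology p \<Omega>) (weighted_comp \<Omega> \<omega> \<psi>) \<longrightarrow>
            chaotic_map (Cp_topology p \<Omega>) (weighted_comp \<Omega> \<omega> \<psi>))
       \<and> (\<forall>\<omega> :: real^'d \<Rightarrow> complex. Cp_on p \<Omega> \<omega> \<longrightarrow>
            mixing_map (Cp_topology p \<Omega>) (weighted_comp \<Omega> \<omega> \<psi>) \<longrightarrow>
            chaotic_map (Cp_topology p \<Omega>) (weighted_comp \<Omega> \<omega> \<psi>))"
  by (intro conjI allI impI weighted_composition.mixing_imp_chaotic weighted_compositionI assms)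

end
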